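(* Let $A$ and $B$ be 0-1 matrices of sizes $p\times q$ and $q\times r$, respectively, and let $\ell\in[p]$ and $k\in[r]$ be given positive integer parameters. There is a deterministic algorithm which computes a $p\times r$ matrix $D$ approximating every entry of the arithmetic matrix product $C=AB$ within an additive error, namely $|C_{ij}-D_{ij}|$ for all $i\in[p]$, $j\in[r]$, of at most: (1) $2\lambda(A,\ell,\mathrm{row})$, in time $O(pq\ell+pr)$, if $p\ge r$; (2) $2\lambda(B,k,\mathrm{col})$, in time $O(rqk+pr)$, if $p\le r$.
   Context: For a positive integer $r$, $[r]=\{1,\dots,r\}$. The arithmetic matrix product $C=AB$ has entries $C_{ij}=\sum_{h=1}^q A_{ih}B_{hj}$ (computed over the integers). The Hamming distance $\mathrm{ham}(a,b)$ between $a,b\in\{0,1\}^q$ is the number of coordinates in which they differ. For a 0-1 $p\times q$ matrix $A$, $\lambda(A,\ell,\mathrm{row})$ is the minimum, over all sets $T$ of $\ell$ points of $\{0,1\}^q$ (not necessarily rows of $A$), of $\max_{i\in[p]}\min_{u\in T}\mathrm{ham}(A_{i*},u)$, where $A_{i*}$ is the $i$-th row of $A$. For a 0-1 $q\times r$ matrix $B$, $\lambda(B,k,\mathrm{col})$ is the analogous minimum, over all sets of $k$ points of $\{0,1\}^q$, of the maximum Hamming distance from a column of $B$ to its closest point in the set. Running times are in the standard RAM model. *)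

theory Defs
  imports Main
begin

text \<open>Arithmetic expressions over registers. Every intermediate value must have
absolute value at most the word bound W (otherwise evaluation is undefined),
which models the standard word-RAM with polynomially bounded words.\<close>

datatype aexp =
    N int | R nat
  | Plus aexp aexp | Minus aexp aexp | Times aexp aexp
  | Div aexp aexp | Mod aexp aexp
  | Less aexp aexp | Equal aexp aexp

fun asize :: "aexp \<Rightarrow> nat" where
  "asize (N _) = 1"
| "asize (R _) = 1"
| "asize (Plus a b) = 1 + asize a + asize b"
| "asize (Minus a b) = 1 + asize a + asize b"
| "asize (Times a b) = 1 + asize a + asize b"
| "asize (Div a b) = 1 + asize a + asize b"
| "asize (Mod a b) = 1 + asize a + asize b"
| "asize (Less a b) = 1 + asize a + asize b"
| "asize (Equal a b) = 1 + asize a + asize b"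

definition chk :: "int \<Rightarrow> int \<Rightarrow> int option" where
  "chk W v = (if \<bar>v\<bar> \<le> W then Some v else None)"

fun aval :: "int \<Rightarrow> aexp \<Rightarrow> (nat \<Rightarrow> int) \<Rightarrow> int option" where
  "aval W (N n) rg = chk W n"
| "aval W (R x) rg = chk W (rg x)"
| "aval W (Plus a b) rg = Option.bind (aval W a rg) (\<lambda>u. Option.bind (aval W b rg) (\<lambda>v. chk W (u + v)))"
| "aval W (Minus a b) rg = Option.bind (aval W a rg) (\<lambda>u. Option.bind (aval W b rg) (\<lambda>v. chk W (u - v)))"
| "aval W (Times a b) rg = Option.bind (aval W a rg) (\<lambda>u. Option.bind (aval W b rg) (\<lambda>v. chk W (u * v)))"
| "aval W (Div a b) rg = Option.bind (aval W a rg) (\<lambda>u. Option.bind (aval W b rg) (\<lambda>v. chk W (u div v)))"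
| "aval W (Mod a b) rg = Option.bind (aval W a rg) (\<lambda>u. Option.bind (aval W b rg) (\<lambda>v. chk W (u mod v)))"
| "aval W (Less a b) rg = Option.bind (aval W a rg) (\<lambda>u. Option.bind (aval W b rg) (\<lambda>v. Some (if u < v then 1 else 0)))"
| "aval W (Equal a b) rg = Option.bind (aval W a rg) (\<lambda>u. Option.bind (aval W b rg) (\<lambda>v. Some (if u = v then 1 else 0)))"

datatype com =
    SKIP
  | Assign nat aexp
  | Load nat aexp
  | Store aexp aexp
  | Seq com com
  | If aexp com com
  | While aexp com

type_synonym state = "(nat \<Rightarrow> int) \<times> (int \<Rightarrow> int)"

inductive big_step :: "int \<Rightarrow> com \<Rightarrow> state \<Rightarrow> nat \<Rightarrow> state \<Rightarrow> bool" where
  Skip: "big_step W SKIP s 1 s"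
| Assign: "aval W e rg = Some v \<Longrightarrow> big_step W (Assign x e) (rg, m) (1 + asize e) (rg(x := v), m)"
| Load: "aval W e rg = Some a \<Longrightarrow> big_step W (Load x e) (rg, m) (1 + asize e) (rg(x := m a), m)"
| Store: "aval W e1 rg = Some a \<Longrightarrow> aval W e2 rg = Some v \<Longrightarrow>
          big_step W (Store e1 e2) (rg, m) (1 + asize e1 + asize e2) (rg, m(a := v))"
| Seq: "big_step W c1 s t1 s1 \<Longrightarrow> big_step W c2 s1 t2 s2 \<Longrightarrow> big_step W (Seq c1 c2) s (t1 + t2) s2"
| IfT: "aval W b rg = Some v \<Longrightarrow> v \<noteq> 0 \<Longrightarrow> big_step W c1 (rg, m) t s' \<Longrightarrow>
        big_step W (If b c1 c2) (rg, m) (1 + asize b + t) s'"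
| IfF: "aval W b rg = Some 0 \<Longrightarrow> big_step W c2 (rg, m) t s' \<Longrightarrow>
        big_step W (If b c1 c2) (rg, m) (1 + asize b + t) s'"
| WhileF: "aval W b rg = Some 0 \<Longrightarrow> big_step W (While b c) (rg, m) (1 + asize b) (rg, m)"
| WhileT: "aval W b rg = Some v \<Longrightarrow> v \<noteq> 0 \<Longrightarrow> big_step W c (rg, m) t1 s1 \<Longrightarrow>
           big_step W (While b c) s1 t2 s2 \<Longrightarrow> big_step W (While b c) (rg, m) (1 + asize b + t1 + t2) s2"

text \<open>Matrices are functions on 1-based indices. Input: registers 0,1,2,3 hold
p, q, r and the parameter (\<ell> or k); memory holds A row-major at addresses
0..pq-1 (A i h at (i-1)q+(h-1)), then B row-major at pq..pq+qr-1
(B h j at pq+(h-1)r+(j-1)); all other cells are 0. Output: D i j is read from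
address pq+qr+(i-1)r+(j-1) of the final memory.\<close>

definition init_state :: "nat \<Rightarrow> nat \<Rightarrow> nat \<Rightarrow> nat \<Rightarrow> (nat \<Rightarrow> nat \<Rightarrow> int) \<Rightarrow> (nat \<Rightarrow> nat \<Rightarrow> int) \<Rightarrow> state" where
  "init_state p q r par A B =
     ((\<lambda>_. 0)(0 := int p, 1 := int q, 2 := int r, 3 := int par),
      (\<lambda>a. if a < 0 then 0
           else if nat a < p * q then A (nat a div q + 1) (nat a mod q + 1)
           else if nat a < p * q + q * r then B ((nat a - p * q) div r + 1) ((nat a - p * q) mod r + 1)
           else 0))"

definition ram_output :: "nat \<Rightarrow> nat \<Rightarrow> nat \<Rightarrow> state \<Rightarrow> nat \<Rightarrow> nat \<Rightarrow> int" where
  "ram_output p q r s i j = snd s (int (p * q + q * r + (i - 1) * r + (j - 1)))"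

definition zero_one :: "(nat \<Rightarrow> nat \<Rightarrow> int) \<Rightarrow> nat \<Rightarrow> nat \<Rightarrow> bool" where
  "zero_one M m n = (\<forall>i\<in>{1..m}. \<forall>j\<in>{1..n}. M i j \<in> {0, 1})"

definition mat_prod :: "nat \<Rightarrow> (nat \<Rightarrow> nat \<Rightarrow> int) \<Rightarrow> (nat \<Rightarrow> nat \<Rightarrow> int) \<Rightarrow> nat \<Rightarrow> nat \<Rightarrow> int" where
  "mat_prod q A B i j = (\<Sum>h = 1..q. A i h * B h j)"

text \<open>Points of {0,1}^q are functions nat \<Rightarrow> int, normalised to 0 outside coordinates 1..q.\<close>

definition cube :: "nat \<Rightarrow> (nat \<Rightarrow> int) set" where
  "cube q = {u. (\<forall>h\<in>{1..q}. u h \<in> {0, 1}) \<and> (\<forall>h. h \<notin> {1..q} \<longrightarrow> u h = 0)}"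

definition ham :: "nat \<Rightarrow> (nat \<Rightarrow> int) \<Rightarrow> (nat \<Rightarrow> int) \<Rightarrow> nat" where
  "ham q a b = card {h\<in>{1..q}. a h \<noteq> b h}"

definition lambda_row :: "nat \<Rightarrow> nat \<Rightarrow> (nat \<Rightarrow> nat \<Rightarrow> int) \<Rightarrow> nat \<Rightarrow> nat" where
  "lambda_row p q A l = (LEAST d. \<exists>T. T \<subseteq> cube q \<and> finite T \<and> T \<noteq> {} \<and>
       card T \<le> l \<and>
       (\<forall>i\<in>{1..p}. \<exists>u\<in>T. ham q (\<lambda>h. A i h) u \<le> d))"

definition lambda_col :: "nat \<Rightarrow> nat \<Rightarrow> (nat \<Rightarrow> nat \<Rightarrow> int) \<Rightarrow> nat \<Rightarrow> nat" where
  "lambda_col q r B k = (LEAST d. \<exists>T. T \<subseteq> cube q \<and> finite T \<and> T \<noteq> {} \<and>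
       card T \<le> k \<and>
       (\<forall>j\<in>{1..r}. \<exists>u\<in>T. ham q (\<lambda>h. B h j) u \<le> d))"

end

theory Submission
  imports Defs
begin

text \<open>Cluster the \<open>n\<close> rows of A (in the second case, columns of B) around \<open>l\<close> of them by
farthest-first traversal (Gonzalez): \<open>l\<close> times, take the row farthest from the centres chosen so far as
a new centre and reassign the rows that are closer to it. Every row ends up within twice the optimal
radius \<open>\<lambda>\<close> of its centre, because otherwise that row together with the \<open>l\<close> centres would be \<open>l + 1\<close>
points at pairwise distance above \<open>2\<lambda>\<close>, two of which lie within \<open>\<lambda>\<close> of the same point of an optimal
solution. The product is computed exactly for the centres only, in time \<open>O(lqr)\<close>, which \<open>r \<le> p\<close> bounds
by \<open>O(pql)\<close>, and copied to all other rows; replacing a row by one at Hamming distance \<open>d\<close> changes an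
inner product with a 0-1 vector by at most \<open>d\<close>.\<close>

section \<open>Timed total correctness\<close>

fun ev :: "aexp \<Rightarrow> (nat \<Rightarrow> int) \<Rightarrow> int" where
  "ev (N n) rg = n"
| "ev (R x) rg = rg x"
| "ev (Plus a b) rg = ev a rg + ev b rg"
| "ev (Minus a b) rg = ev a rg - ev b rg"
| "ev (Times a b) rg = ev a rg * ev b rg"
| "ev (Div a b) rg = ev a rg div ev b rg"
| "ev (Mod a b) rg = ev a rg mod ev b rg"
| "ev (Less a b) rg = (if ev a rg < ev b rg then 1 else 0)"
| "ev (Equal a b) rg = (if ev a rg = ev b rg then 1 else 0)"

text \<open>The limit 2 on constants matches the assumption \<open>2 \<le> K\<close>, so constants
  obey the same bound as registers.\<close>

fun simple :: "aexp \<Rightarrow> bool" where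
  "simple (N n) \<longleftrightarrow> \<bar>n\<bar> \<le> 2"
| "simple (R x) \<longleftrightarrow> True"
| "simple (Plus a b) \<longleftrightarrow> simple a \<and> simple b"
| "simple (Minus a b) \<longleftrightarrow> simple a \<and> simple b"
| "simple (Times a b) \<longleftrightarrow> simple a \<and> simple b"
| "simple (Div a b) \<longleftrightarrow> False"
| "simple (Mod a b) \<longleftrightarrow> False"
| "simple (Less a b) \<longleftrightarrow> simple a \<and> simple b"
| "simple (Equal a b) \<longleftrightarrow> simple a \<and> simple b"

definition bounded_regs :: "int \<Rightarrow> (nat \<Rightarrow> int) \<Rightarrow> bool" where
  "bounded_regs K rg \<longleftrightarrow> (\<forall>x. \<bar>rg x\<bar> \<le> K)"

text \<open>Induction on the expression. The size unit of the operator itself pays for the doubling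
  in a sum: \<open>K ^ m + K ^ n\<close> is at most \<open>2 * K ^ (m + n)\<close>, and
  \<open>2 \<le> K\<close>.\<close>

lemma abs_ev_le_power:
  assumes "bounded_regs K rg" and "2 \<le> K" and "simple e"
  shows "\<bar>ev e rg\<bar> \<le> K ^ asize e"
  using assms(3)
proof (induction e)
  have sum: "K ^ m + K ^ n \<le> K ^ (1 + m + n)" for m n
  proof -
    have "K ^ m \<le> K ^ (m + n)" "K ^ n \<le> K ^ (m + n)"
      using assms(2) by (auto intro: power_increasing)
    moreover have "2 * K ^ (m + n) \<le> K * K ^ (m + n)"
      using assms(2) by (intro mult_right_mono) auto
    ultimately show ?thesis by simp
  qed
  have one: "1 \<le> K ^ n" for n using assms(2) by (simp add: one_le_power)
  {
    case (Plus a b) then show ?case using sum[of "asize a" "asize b"] by simp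
  next
    case (Minus a b) then show ?case using sum[of "asize a" "asize b"] by simp
  next
    case (Times a b)
    then have "\<bar>ev a rg\<bar> * \<bar>ev b rg\<bar> \<le> K ^ asize a * K ^ asize b"
      using assms(2) by (intro mult_mono) auto
    also have "\<dots> = K ^ (asize a + asize b)" by (simp add: power_add)
    also have "\<dots> \<le> K ^ (1 + asize a + asize b)"
      using assms(2) by (intro power_increasing) auto
    finally show ?case by (simp add: abs_mult)
  next
    case (Less a b)
    then show ?case using one[of "asize (Less a b)"] by simp
  next
    case (Equal a b)
    then show ?case using one[of "asize (Equal a b)"] by simp
  }
qed (use assms in \<open>auto simp: bounded_regs_def\<close>)

text \<open>Subexpressions are smaller still, so every intermediate value passes the word check, not
  just the final one.\<close>

lemma aval_eq_ev:
  assumes "bounded_regs K rg" and "2 \<le> K" and "simple e" and "asize e \<le> w"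
  shows "aval (K ^ w) e rg = Some (ev e rg)"
  using assms(3,4)
proof (induction e)
  have chk: "chk (K ^ w) (ev e rg) = Some (ev e rg)" if "simple e" "asize e \<le> w" for e
  proof -
    have "K ^ asize e \<le> K ^ w" using assms(2) that(2) by (intro power_increasing) auto
    then show ?thesis
      using abs_ev_le_power[OF assms(1,2) that(1)] by (simp add: chk_def)
  qed
  {
    case (N n) then show ?case using chk[of "N n"] by simp
  next
    case (R n) then show ?case using chk[of "R n"] by simp
  next
    case (Plus a b) then show ?case using chk[of "Plus a b"] by simp
  next
    case (Minus a b) then show ?case using chk[of "Minus a b"] by simp
  next
    case (Times a b) then show ?case using chk[of "Times a b"] by simp
  }
qed auto

text \<open>The limit 40 leaves room for the largest address in use, an entry address of size at
  most 20 shifted by \<open>p * r\<close>.\<close>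

definition fit :: "aexp \<Rightarrow> bool" where
  "fit e \<longleftrightarrow> simple e \<and> asize e \<le> 40"

text \<open>Total correctness with a time budget. If all registers stay below K, then no expression
of size at most 40 exceeds the word bound \<open>K ^ 40\<close>, so overflow never has to be discussed again.\<close>

definition run :: "int \<Rightarrow> com \<Rightarrow> nat \<Rightarrow> state \<Rightarrow> ((nat \<Rightarrow> int) \<Rightarrow> (int \<Rightarrow> int) \<Rightarrow> bool) \<Rightarrow> bool" where
  "run K c T s Q \<longleftrightarrow> (2 \<le> K \<and> bounded_regs K (fst s) \<longrightarrow>
     (\<exists>t rg m. big_step (K ^ 40) c s t (rg, m) \<and> t \<le> T \<and> bounded_regs K rg \<and> Q rg m))"

section \<open>Proof rules for timed total correctness\<close>

lemma run_weaken:
  assumes "run K c T s Q" and "\<And>rg m. Q rg m \<Longrightarrow> Q' rg m" and "T \<le> T'"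
  shows "run K c T' s Q'"
  using assms unfolding run_def by (meson order_trans)

lemma run_time: "run K c T s Q \<Longrightarrow> T \<le> T' \<Longrightarrow> run K c T' s Q"
  using run_weaken by blast

lemma run_conseq: "run K c T s Q \<Longrightarrow> (\<And>rg m. Q rg m \<Longrightarrow> Q' rg m) \<Longrightarrow> run K c T s Q'"
  using run_weaken by blast

lemma run_Skip: "Q rg m \<Longrightarrow> run K SKIP 1 (rg, m) Q"
  unfolding run_def using big_step.Skip by fastforce

lemma run_Assign:
  assumes "Q (rg(x := ev e rg)) m" and "fit e" and "\<bar>ev e rg\<bar> \<le> K"
  shows "run K (Assign x e) (1 + asize e) (rg, m) Q"
  using assms aval_eq_ev[of K rg e 40] big_step.Assign[of "K ^ 40" e rg "ev e rg" x m]
  unfolding run_def fit_def bounded_regs_def by fastforce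

text \<open>Memory cells carry no bound in \<open>run\<close>, so each load has to justify that the
  value fits the register bound.\<close>

lemma run_Load:
  assumes "Q (rg(x := m (ev e rg))) m" and "fit e" and "\<bar>m (ev e rg)\<bar> \<le> K"
  shows "run K (Load x e) (1 + asize e) (rg, m) Q"
  using assms aval_eq_ev[of K rg e 40] big_step.Load[of "K ^ 40" e rg "ev e rg" x m]
  unfolding run_def fit_def bounded_regs_def by fastforce

lemma run_Store:
  assumes "Q rg (m(ev e rg := ev e' rg))" and "fit e" and "fit e'"
  shows "run K (Store e e') (1 + asize e + asize e') (rg, m) Q"
  using assms aval_eq_ev[of K rg e 40] aval_eq_ev[of K rg e' 40]
    big_step.Store[of "K ^ 40" e rg "ev e rg" e' "ev e' rg" m]
  unfolding run_def fit_def by fastforce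

text \<open>In weakest-precondition style, the postcondition of \<open>c\<close> is the run of
  \<open>c'\<close>. Repeated application of the rules thus executes straight-line code
  symbolically.\<close>

lemma run_Seq:
  assumes "run K c T (rg, m) (\<lambda>rg' m'. run K c' T' (rg', m') Q)"
  shows "run K (Seq c c') (T + T') (rg, m) Q"
  using assms unfolding run_def fst_conv
  by (meson add_mono big_step.Seq)

text \<open>The budget adds both branches instead of taking their maximum. Branches here have
  constant cost, so this only affects constants.\<close>

lemma run_If:
  assumes "fit b" and "ev b rg \<noteq> 0 \<Longrightarrow> run K c T (rg, m) Q" and "ev b rg = 0 \<Longrightarrow> run K c' T' (rg, m) Q"
  shows "run K (If b c c') (1 + asize b + (T + T')) (rg, m) Q"
  unfolding run_def
proof (intro impI, elim conjE)
  assume K: "2 \<le> K" and bd: "bounded_regs K (fst (rg, m))"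
  have av: "aval (K ^ 40) b rg = Some (ev b rg)"
    using assms(1) aval_eq_ev[of K rg b 40] K bd by (simp add: fit_def)
  show "\<exists>t rg' m'. big_step (K ^ 40) (If b c c') (rg, m) t (rg', m') \<and> t \<le> 1 + asize b + (T + T') \<and>
      bounded_regs K rg' \<and> Q rg' m'"
  proof (cases "ev b rg = 0")
    case True
    then obtain t rg' m' where "big_step (K ^ 40) c' (rg, m) t (rg', m')" "t \<le> T'" "bounded_regs K rg'" "Q rg' m'"
      using assms(3) K bd unfolding run_def by blast
    moreover from this have "big_step (K ^ 40) (If b c c') (rg, m) (1 + asize b + t) (rg', m')"
      using av True by (intro big_step.IfF) simp_all
    ultimately show ?thesis by (meson add_left_mono order_trans trans_le_add2)
  next
    case False
    then obtain t rg' m' where "big_step (K ^ 40) c (rg, m) t (rg', m')" "t \<le> T" "bounded_regs K rg'" "Q rg' m'"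
      using assms(2) K bd unfolding run_def by blast
    moreover from this have "big_step (K ^ 40) (If b c c') (rg, m) (1 + asize b + t) (rg', m')"
      using av False by (intro big_step.IfT) simp_all
    ultimately show ?thesis by (meson add_left_mono order_trans trans_le_add1)
  qed
qed

text \<open>The cut form of sequencing, for a first component that already has a proved
  specification \<open>Q\<close>.\<close>

lemma run_Seq_via:
  assumes "run K c T (rg, m) Q" and "\<And>rg' m'. Q rg' m' \<Longrightarrow> run K c' T' (rg', m') Q'"
  shows "run K (Seq c c') (T + T') (rg, m) Q'"
  using assms by (blast intro: run_Seq run_weaken)

lemmas run_straight = run_Seq run_Assign run_Load run_Store run_Skip

definition For :: "nat \<Rightarrow> nat \<Rightarrow> com \<Rightarrow> com" where
  "For x y c = Seq (Assign x (N 0)) (While (Less (R x) (R y)) (Seq c (Assign x (Plus (R x) (N 1)))))"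

text \<open>An iteration costs 4 for the test and 4 for the increment besides the body; the initial
  assignment (2) and the failing test (4) give the final 6. The body has to leave counter and limit
  unchanged and establish the invariant for the counter as it will be after the increment.\<close>

lemma run_For:
  fixes I :: "nat \<Rightarrow> (nat \<Rightarrow> int) \<Rightarrow> (int \<Rightarrow> int) \<Rightarrow> bool"
  assumes lim: "rg y = int n" "int n \<le> K" "x \<noteq> y"
    and init: "I 0 (rg(x := 0)) m"
    and step: "\<And>k rg m. k < n \<Longrightarrow> I k rg m \<Longrightarrow> rg x = int k \<Longrightarrow> rg y = int n \<Longrightarrow>
      run K c T (rg, m) (\<lambda>rg' m'. rg' x = int k \<and> rg' y = int n \<and> I (Suc k) (rg'(x := int (Suc k))) m')"
    and post: "\<And>rg m. I n rg m \<Longrightarrow> rg x = int n \<Longrightarrow> rg y = int n \<Longrightarrow> Q rg m"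
  shows "run K (For x y c) (n * (T + 8) + 6) (rg, m) Q"
  unfolding run_def
proof (intro impI, elim conjE)
  assume K: "2 \<le> K" and bd: "bounded_regs K (fst (rg, m))"
  let ?b = "Less (R x) (R y)"
  let ?B = "Seq c (Assign x (Plus (R x) (N 1)))"
  \<comment> \<open>Induction on the number \<open>d\<close> of iterations still to come, with the
    \<open>k\<close> completed ones generalised.\<close>
  have loop: "\<exists>t rg' m'. big_step (K ^ 40) (While ?b ?B) (rg, m) t (rg', m') \<and>
      t \<le> d * (T + 8) + 4 \<and> bounded_regs K rg' \<and> Q rg' m'"
    if "d + k = n" "I k rg m" "rg x = int k" "rg y = int n" "bounded_regs K rg" for d k rg m
    using that
  proof (induction d arbitrary: k rg m)
    case 0
    have "aval (K ^ 40) ?b rg = Some 0"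
      using aval_eq_ev[of K rg ?b 40] K 0 by simp
    then have "big_step (K ^ 40) (While ?b ?B) (rg, m) (1 + asize ?b) (rg, m)"
      by (rule big_step.WhileF)
    then show ?case using 0 post by fastforce
  next
    case (Suc d)
    have b: "aval (K ^ 40) ?b rg = Some 1"
      using aval_eq_ev[of K rg ?b 40] K Suc.prems by simp
    obtain t1 rg1 m1 where c: "big_step (K ^ 40) c (rg, m) t1 (rg1, m1)" "t1 \<le> T"
        "bounded_regs K rg1" "rg1 x = int k" "rg1 y = int n" "I (Suc k) (rg1(x := int (Suc k))) m1"
      using step[of k rg m] Suc.prems K unfolding run_def by auto
    let ?rg2 = "rg1(x := int (Suc k))"
    have bd2: "bounded_regs K ?rg2"
      using c(3) Suc.prems(1) lim by (auto simp: bounded_regs_def)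
    have "aval (K ^ 40) (Plus (R x) (N 1)) rg1 = Some (int (Suc k))"
      using aval_eq_ev[of K rg1 "Plus (R x) (N 1)" 40] K c by simp
    then have inc: "big_step (K ^ 40) (Assign x (Plus (R x) (N 1))) (rg1, m1)
        (1 + asize (Plus (R x) (N 1))) (?rg2, m1)"
      by (rule big_step.Assign)
    obtain t2 rg3 m3 where w: "big_step (K ^ 40) (While ?b ?B) (?rg2, m1) t2 (rg3, m3)"
        "t2 \<le> d * (T + 8) + 4" "bounded_regs K rg3" "Q rg3 m3"
      using Suc.IH[OF _ c(6) _ _ bd2] Suc.prems(1) c(5) lim(3)
      by (metis add_Suc_shift fun_upd_other fun_upd_same)
    have "big_step (K ^ 40) (While ?b ?B) (rg, m) (1 + asize ?b + (t1 + (1 + asize (Plus (R x) (N 1)))) + t2) (rg3, m3)"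
      by (rule big_step.WhileT[OF b _ big_step.Seq[OF c(1) inc] w(1)]) simp
    then show ?case using w c(2) by fastforce
  qed
  have "aval (K ^ 40) (N 0) rg = Some 0"
    using aval_eq_ev[of K rg "N 0" 40] K bd by simp
  then have init_step: "big_step (K ^ 40) (Assign x (N 0)) (rg, m) (1 + asize (N 0)) (rg(x := 0), m)"
    by (rule big_step.Assign)
  have "bounded_regs K (rg(x := 0))" using bd K by (auto simp: bounded_regs_def)
  then obtain t rg' m' where "big_step (K ^ 40) (While ?b ?B) (rg(x := 0), m) t (rg', m')"
      "t \<le> n * (T + 8) + 4" "bounded_regs K rg'" "Q rg' m'"
    using loop[of n 0 "rg(x := 0)" m] init lim by auto
  moreover from this have "big_step (K ^ 40) (For x y c) (rg, m) (1 + asize (N 0) + t) (rg', m')"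
    unfolding For_def by (intro big_step.Seq[OF init_step])
  ultimately show "\<exists>t rg' m'. big_step (K ^ 40) (For x y c) (rg, m) t (rg', m') \<and>
      t \<le> n * (T + 8) + 6 \<and> bounded_regs K rg' \<and> Q rg' m'"
    by fastforce
qed

section \<open>The program\<close>

text \<open>Register usage: 0--3 input, 4 round, 5 current centre, 6 point, 7 coordinate, 8 accumulator,
9 and 10 operands, 11 smallest agreement so far, 12 point attaining it, 13 index into the other matrix.
Point \<open>i\<close> keeps its agreement with its centre at address \<open>-1-i\<close> and that centre at \<open>-1-n-i\<close>.
Storing agreements instead of distances makes the all-zero memory a valid initialisation.\<close>

definition best_addr :: aexp where
  "best_addr = Minus (N (-1)) (R 6)"

definition centre_addr :: "nat \<Rightarrow> aexp" where
  "centre_addr rn = Minus (Minus (N (-1)) (R rn)) (R 6)"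

text \<open>The shift by \<open>p * r\<close> places the results for centres beyond the output
  block, so writing output never destroys a result that is still to be copied.\<close>

definition exact_addr :: "(nat \<Rightarrow> nat \<Rightarrow> aexp) \<Rightarrow> aexp" where
  "exact_addr aO = Plus (aO 5 13) (Times (R 0) (R 2))"

definition agree_prog :: "(nat \<Rightarrow> nat \<Rightarrow> aexp) \<Rightarrow> com" where
  "agree_prog aX = Seq (Assign 8 (N 0)) (For 7 1
     (Seq (Load 9 (aX 6 7)) (Seq (Load 10 (aX 5 7)) (Assign 8 (Plus (R 8) (Equal (R 9) (R 10)))))))"

text \<open>Ties count as improvements in both tests. In the first round all stored agreements are
  0, so every point is assigned, even one that agrees with the centre nowhere. As register 11 starts
  at \<open>q\<close>, the first point always enters register 12.\<close>

definition update_prog :: "nat \<Rightarrow> (nat \<Rightarrow> nat \<Rightarrow> aexp) \<Rightarrow> com" where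
  "update_prog rn aX = For 6 rn
     (Seq (agree_prog aX) (Seq (Load 9 best_addr)
     (Seq (If (Less (R 8) (R 9)) SKIP
            (Seq (Store best_addr (R 8)) (Seq (Store (centre_addr rn) (R 5)) (Assign 9 (R 8)))))
          (If (Less (R 11) (R 9)) SKIP (Seq (Assign 11 (R 9)) (Assign 12 (R 6)))))))"

definition dot_prog :: "(nat \<Rightarrow> nat \<Rightarrow> aexp) \<Rightarrow> (nat \<Rightarrow> nat \<Rightarrow> aexp) \<Rightarrow> com" where
  "dot_prog aX aY = Seq (Assign 8 (N 0)) (For 7 1
     (Seq (Load 9 (aX 5 7)) (Seq (Load 10 (aY 7 13)) (Assign 8 (Plus (R 8) (Times (R 9) (R 10)))))))"

definition exact_prog :: "nat \<Rightarrow> (nat \<Rightarrow> nat \<Rightarrow> aexp) \<Rightarrow> (nat \<Rightarrow> nat \<Rightarrow> aexp) \<Rightarrow> (nat \<Rightarrow> nat \<Rightarrow> aexp) \<Rightarrow> com" where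
  "exact_prog rm aX aY aO = For 13 rm (Seq (dot_prog aX aY) (Store (exact_addr aO) (R 8)))"

text \<open>Register 5 is initially 0, which makes point 0 the first centre. The candidate found in
  the last round is no longer used as a centre.\<close>

definition cluster_prog :: "nat \<Rightarrow> nat \<Rightarrow> (nat \<Rightarrow> nat \<Rightarrow> aexp) \<Rightarrow> (nat \<Rightarrow> nat \<Rightarrow> aexp) \<Rightarrow> (nat \<Rightarrow> nat \<Rightarrow> aexp) \<Rightarrow> com" where
  "cluster_prog rn rm aX aY aO = For 4 3
     (Seq (Assign 11 (R 1)) (Seq (update_prog rn aX) (Seq (exact_prog rm aX aY aO) (Assign 5 (R 12)))))"

definition copy_prog :: "nat \<Rightarrow> nat \<Rightarrow> (nat \<Rightarrow> nat \<Rightarrow> aexp) \<Rightarrow> com" where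
  "copy_prog rn rm aO = For 6 rn
     (Seq (Load 5 (centre_addr rn)) (For 13 rm (Seq (Load 9 (exact_addr aO)) (Store (aO 6 13) (R 9)))))"

definition approx_prog :: "nat \<Rightarrow> nat \<Rightarrow> (nat \<Rightarrow> nat \<Rightarrow> aexp) \<Rightarrow> (nat \<Rightarrow> nat \<Rightarrow> aexp) \<Rightarrow> (nat \<Rightarrow> nat \<Rightarrow> aexp) \<Rightarrow> com" where
  "approx_prog rn rm aX aY aO = Seq (cluster_prog rn rm aX aY aO) (copy_prog rn rm aO)"

section \<open>Agreement counts and inner products\<close>

definition agree :: "nat \<Rightarrow> (nat \<Rightarrow> nat \<Rightarrow> int) \<Rightarrow> nat \<Rightarrow> nat \<Rightarrow> int" where
  "agree q X i c = (\<Sum>h<q. if X i h = X c h then 1 else 0)"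

definition dot :: "nat \<Rightarrow> (nat \<Rightarrow> nat \<Rightarrow> int) \<Rightarrow> (nat \<Rightarrow> nat \<Rightarrow> int) \<Rightarrow> nat \<Rightarrow> nat \<Rightarrow> int" where
  "dot q X Y i j = (\<Sum>h<q. X i h * Y h j)"

lemma agree_simps [simp]:
  "agree 0 X i c = 0"
  "agree (Suc k) X i c = agree k X i c + (if X i k = X c k then 1 else 0)"
  by (simp_all add: agree_def)

lemma dot_simps [simp]: "dot 0 X Y i j = 0" "dot (Suc k) X Y i j = dot k X Y i j + X i k * Y k j"
  by (simp_all add: dot_def)

lemma agree_bounds: "0 \<le> agree q X i c" "agree q X i c \<le> int q"
proof -
  show "0 \<le> agree q X i c" unfolding agree_def by (intro sum_nonneg) auto
  have "agree q X i c \<le> (\<Sum>h<q. 1)" unfolding agree_def by (intro sum_mono) auto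
  then show "agree q X i c \<le> int q" by simp
qed

definition same_except :: "nat set \<Rightarrow> (nat \<Rightarrow> int) \<Rightarrow> (nat \<Rightarrow> int) \<Rightarrow> bool" where
  "same_except V rg rg' \<longleftrightarrow> (\<forall>x. x \<notin> V \<longrightarrow> rg' x = rg x)"

text \<open>\<open>X\<close> lists the \<open>n\<close> vectors to be clustered (rows of A or columns of B) and \<open>Y\<close> the other
matrix, both with 0-based indices; \<open>oX\<close>, \<open>oY\<close>, \<open>oO\<close> are the addresses of their entries and of the output.\<close>

locale layout =
  fixes p q r l n m rn rm :: nat
    and aX aY aO :: "nat \<Rightarrow> nat \<Rightarrow> aexp"
    and oX oY oO :: "int \<Rightarrow> int \<Rightarrow> int"
    and X Y :: "nat \<Rightarrow> nat \<Rightarrow> int"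
    and m0 :: "int \<Rightarrow> int"
    and K :: int
  assumes K: "2 \<le> K" "int n \<le> K" "int m \<le> K" "int q \<le> K" "int l \<le> K"
    and n: "1 \<le> n"
    and side: "(rn = 0 \<and> n = p \<and> rm = 2 \<and> m = r) \<or> (rn = 2 \<and> n = r \<and> rm = 0 \<and> m = p)"
    and simple: "simple (aX x y)" "simple (aY x y)" "simple (aO x y)"
    and asize: "asize (aX x y) \<le> 20" "asize (aY x y) \<le> 20" "asize (aO x y) \<le> 20"
    and ev_aX: "\<lbrakk>rg 0 = int p; rg 1 = int q; rg 2 = int r\<rbrakk> \<Longrightarrow> ev (aX x y) rg = oX (rg x) (rg y)"
    and ev_aY: "\<lbrakk>rg 0 = int p; rg 1 = int q; rg 2 = int r\<rbrakk> \<Longrightarrow> ev (aY x y) rg = oY (rg x) (rg y)"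
    and ev_aO: "\<lbrakk>rg 0 = int p; rg 1 = int q; rg 2 = int r\<rbrakk> \<Longrightarrow> ev (aO x y) rg = oO (rg x) (rg y)"
    and oX: "\<lbrakk>i < n; h < q\<rbrakk> \<Longrightarrow> 0 \<le> oX (int i) (int h) \<and> oX (int i) (int h) < int (p * q + q * r) \<and>
      m0 (oX (int i) (int h)) = X i h"
    and oY: "\<lbrakk>h < q; j < m\<rbrakk> \<Longrightarrow> 0 \<le> oY (int h) (int j) \<and> oY (int h) (int j) < int (p * q + q * r) \<and>
      m0 (oY (int h) (int j)) = Y h j"
    and oO: "\<lbrakk>i < n; j < m\<rbrakk> \<Longrightarrow> int (p * q + q * r) \<le> oO (int i) (int j) \<and>
      oO (int i) (int j) < int (p * q + q * r) + int (p * r)"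
    and inj_oO: "\<lbrakk>i < n; j < m; i' < n; j' < m; oO (int i) (int j) = oO (int i') (int j')\<rbrakk> \<Longrightarrow> i = i' \<and> j = j'"
    and X01: "\<lbrakk>i < n; h < q\<rbrakk> \<Longrightarrow> X i h \<in> {0, 1}"
    and Y01: "\<lbrakk>h < q; j < m\<rbrakk> \<Longrightarrow> Y h j \<in> {0, 1}"
    and m0_neg: "a < 0 \<Longrightarrow> m0 a = 0"
begin

definition sizes :: "(nat \<Rightarrow> int) \<Rightarrow> bool" where
  "sizes rg \<longleftrightarrow> rg 0 = int p \<and> rg 1 = int q \<and> rg 2 = int r \<and> rg 3 = int l"

definition input :: "(int \<Rightarrow> int) \<Rightarrow> bool" where
  "input mem \<longleftrightarrow> (\<forall>a. 0 \<le> a \<and> a < int (p * q + q * r) \<longrightarrow> mem a = m0 a)"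

definition best :: "(int \<Rightarrow> int) \<Rightarrow> nat \<Rightarrow> int" where
  "best mem i = mem (- 1 - int i)"

definition centre :: "(int \<Rightarrow> int) \<Rightarrow> nat \<Rightarrow> int" where
  "centre mem i = mem (- 1 - int n - int i)"

definition exact :: "(int \<Rightarrow> int) \<Rightarrow> int \<Rightarrow> nat \<Rightarrow> int" where
  "exact mem c j = mem (oO c (int j) + int (p * r))"

lemma sizes_rn: "sizes rg \<Longrightarrow> rg rn = int n" and sizes_rm: "sizes rg \<Longrightarrow> rg rm = int m"
  using side by (auto simp: sizes_def)

lemma fit_addrs: "fit (aX x y)" "fit (aY x y)" "fit (aO x y)" "fit (exact_addr aO)"
  using simple asize[of x y] asize[of 5 13] by (auto simp: fit_def exact_addr_def)

lemma input_X: "\<lbrakk>input mem; sizes rg; i < n; h < q; rg x = int i; rg y = int h\<rbrakk> \<Longrightarrow> mem (ev (aX x y) rg) = X i h"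
  using oX[of i h] ev_aX[of rg x y] by (auto simp: input_def sizes_def)

lemma input_Y: "\<lbrakk>input mem; sizes rg; h < q; j < m; rg x = int h; rg y = int j\<rbrakk> \<Longrightarrow> mem (ev (aY x y) rg) = Y h j"
  using oY[of h j] ev_aY[of rg x y] by (auto simp: input_def sizes_def)

section \<open>Loops over the coordinates of two vectors\<close>

lemma run_agree:
  assumes "sizes rg" "input mem" "rg 5 = int c" "rg 6 = int i" "c < n" "i < n"
  shows "run K (agree_prog aX) (70 * q + 10) (rg, mem)
    (\<lambda>rg' mem'. mem' = mem \<and> rg' 8 = agree q X i c \<and> same_except {7, 8, 9, 10} rg rg')"
proof -
  let ?I = "\<lambda>k rg' mem'. mem' = mem \<and> rg' 8 = agree k X i c \<and> same_except {7, 8, 9, 10} rg rg'"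
  \<comment> \<open>Two loads of cost at most 21 and an assignment of cost 6 fit into 60; with loop
    control 8 this stays below 70 per coordinate.\<close>
  have step: "run K (Seq (Load 9 (aX 6 7)) (Seq (Load 10 (aX 5 7)) (Assign 8 (Plus (R 8) (Equal (R 9) (R 10))))))
      60 (rg1, mem1) (\<lambda>rg' mem'. rg' 7 = int k \<and> rg' 1 = int q \<and> ?I (Suc k) (rg'(7 := int (Suc k))) mem')"
    if *: "k < q" "?I k rg1 mem1" "rg1 7 = int k" "rg1 1 = int q" for k rg1 mem1
  proof -
    have regs: "sizes rg1" "rg1 5 = int c" "rg1 6 = int i"
      using * assms by (auto simp: same_except_def sizes_def)
    have "agree (Suc k) X i c \<le> int q"
      using agree_bounds(2)[of "Suc k" X i c] *(1) by linarith
    then have ag: "\<bar>agree k X i c + (if X i k = X c k then 1 else 0)\<bar> \<le> K"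
      using agree_bounds(1)[of k X i c] K(4) by auto
    have l1: "mem (ev (aX 6 7) rg1) = X i k"
      using * regs assms by (intro input_X) auto
    have l2: "mem (ev (aX 5 7) (rg1(9 := X i k))) = X c k"
      using * regs assms by (intro input_X) (auto simp: sizes_def)
    have X01': "\<bar>X i k\<bar> \<le> K" "\<bar>X c k\<bar> \<le> K"
      using X01[of i k] X01[of c k] assms *(1) K(1) by auto
    show ?thesis
      apply (rule run_time)
       apply (rule run_straight)+
      using * ag asize(1)[of 6 7] asize(1)[of 5 7]
      by (auto simp: l1 l2 X01' simple fit_def same_except_def split del: if_split)
  qed
  show ?thesis
    unfolding agree_prog_def
    apply (rule run_time)
     apply (rule run_straight run_For[where I = ?I and n = q, OF _ _ _ _ step])+
    using assms K by (auto simp: fit_def sizes_def same_except_def)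
qed

text \<open>Each term has absolute value at most 1. This keeps the accumulator, and later the copied
  results, within the register bound.\<close>

lemma abs_dot_le:
  assumes "c < n" "j < m" "k \<le> q"
  shows "\<bar>dot k X Y c j\<bar> \<le> int k"
proof -
  have "\<bar>dot k X Y c j\<bar> \<le> (\<Sum>h<k. \<bar>X c h * Y h j\<bar>)"
    unfolding dot_def by (rule sum_abs)
  also have "\<dots> \<le> (\<Sum>h<k. 1)"
  proof (rule sum_mono)
    fix h assume "h \<in> {..<k}"
    then show "\<bar>X c h * Y h j\<bar> \<le> 1"
      using assms X01[of c h] Y01[of h j] by auto
  qed
  finally show ?thesis by simp
qed

lemma run_dot:
  assumes "sizes rg" "input mem" "rg 5 = int c" "rg 13 = int j" "c < n" "j < m"
  shows "run K (dot_prog aX aY) (70 * q + 10) (rg, mem)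
    (\<lambda>rg' mem'. mem' = mem \<and> rg' 8 = dot q X Y c j \<and> same_except {7, 8, 9, 10} rg rg')"
proof -
  let ?I = "\<lambda>k rg' mem'. mem' = mem \<and> rg' 8 = dot k X Y c j \<and> same_except {7, 8, 9, 10} rg rg'"
  have step: "run K (Seq (Load 9 (aX 5 7)) (Seq (Load 10 (aY 7 13)) (Assign 8 (Plus (R 8) (Times (R 9) (R 10))))))
      60 (rg1, mem1) (\<lambda>rg' mem'. rg' 7 = int k \<and> rg' 1 = int q \<and> ?I (Suc k) (rg'(7 := int (Suc k))) mem')"
    if *: "k < q" "?I k rg1 mem1" "rg1 7 = int k" "rg1 1 = int q" for k rg1 mem1
  proof -
    have regs: "sizes rg1" "rg1 5 = int c" "rg1 13 = int j"
      using * assms by (auto simp: same_except_def sizes_def)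
    have d: "\<bar>dot k X Y c j + X c k * Y k j\<bar> \<le> K"
      using abs_dot_le[of c j "Suc k"] K(4) assms *(1) by auto
    have l1: "mem (ev (aX 5 7) rg1) = X c k"
      using * regs assms by (intro input_X) auto
    have l2: "mem (ev (aY 7 13) (rg1(9 := X c k))) = Y k j"
      using * regs assms by (intro input_Y) (auto simp: sizes_def)
    have b01: "\<bar>X c k\<bar> \<le> K" "\<bar>Y k j\<bar> \<le> K"
      using X01[of c k] Y01[of k j] assms *(1) K(1) by auto
    show ?thesis
      apply (rule run_time)
       apply (rule run_straight)+
      using * d asize(2)[of 7 13] asize(1)[of 5 7]
      by (auto simp: l1 l2 b01 simple fit_def same_except_def)
  qed
  show ?thesis
    unfolding dot_prog_def
    apply (rule run_time)
     apply (rule run_straight run_For[where I = ?I and n = q, OF _ _ _ _ step])+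
    using assms K by (auto simp: fit_def sizes_def same_except_def)
qed

section \<open>One pass over the points\<close>

lemma rn_cases: "rn = 0 \<or> rn = 2" and rm_cases: "rm = 0 \<or> rm = 2"
  using side by auto

text \<open>Agreements occupy the addresses from \<open>-1\<close> down to \<open>-n\<close> and
  centres those from \<open>-1-n\<close> downwards; the index bound keeps the two blocks
  apart.\<close>

lemma best_upd [simp]:
  "best (mem(- 1 - int i := v)) i' = (if i' = i then v else best mem i')"
  "i' < n \<Longrightarrow> best (mem(- 1 - int n - int i := v)) i' = best mem i'"
  by (auto simp: best_def)

lemma centre_upd [simp]:
  "centre (mem(- 1 - int n - int i := v)) i' = (if i' = i then v else centre mem i')"
  "i < n \<Longrightarrow> centre (mem(- 1 - int i := v)) i' = centre mem i'"
  by (auto simp: centre_def)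

lemma run_update:
  assumes "sizes rg" "input mem" "rg 5 = int c" "c < n" "rg 11 = int q"
    and best: "\<And>i. i < n \<Longrightarrow> 0 \<le> best mem i \<and> best mem i \<le> int q"
  shows "run K (update_prog rn aX) (n * (70 * q + 100) + 6) (rg, mem)
    (\<lambda>rg' mem'. (\<forall>a\<ge>0. mem' a = mem a) \<and>
      (\<forall>i<n. best mem' i = max (best mem i) (agree q X i c)) \<and>
      (\<forall>i<n. centre mem' i = (if best mem i \<le> agree q X i c then int c else centre mem i)) \<and>
      (\<exists>x<n. rg' 12 = int x \<and> (\<forall>i<n. best mem' x \<le> best mem' i)) \<and>
      same_except {6, 7, 8, 9, 10, 11, 12} rg rg')"
proof -
  \<comment> \<open>Registers 11 and 12 hold the minimum over the first \<open>k\<close> points and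
    a point attaining it. For \<open>k = 0\<close> register 12 means nothing yet and register 11 has
    its starting value \<open>q\<close>.\<close>
  let ?I = "\<lambda>k rg' mem'. (\<forall>a\<ge>0. mem' a = mem a) \<and>
      (\<forall>i<n. best mem' i = (if i < k then max (best mem i) (agree q X i c) else best mem i)) \<and>
      (\<forall>i<n. centre mem' i = (if i < k \<and> best mem i \<le> agree q X i c then int c else centre mem i)) \<and>
      0 \<le> rg' 11 \<and> rg' 11 \<le> int q \<and> (k = 0 \<longrightarrow> rg' 11 = int q) \<and> (\<forall>i<k. rg' 11 \<le> best mem' i) \<and>
      (0 < k \<longrightarrow> (\<exists>x<k. rg' 12 = int x \<and> rg' 11 = best mem' x)) \<and>
      same_except {6, 7, 8, 9, 10, 11, 12} rg rg'"
  let ?upd = "If (Less (R 8) (R 9)) SKIP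
            (Seq (Store best_addr (R 8)) (Seq (Store (centre_addr rn) (R 5)) (Assign 9 (R 8))))"
  let ?min = "If (Less (R 11) (R 9)) SKIP (Seq (Assign 11 (R 9)) (Assign 12 (R 6)))"
  have step: "run K (Seq (agree_prog aX) (Seq (Load 9 best_addr) (Seq ?upd ?min)))
      (70 * q + 80) (rg1, mem1) (\<lambda>rg' mem'. rg' 6 = int k \<and> rg' rn = int n \<and> ?I (Suc k) (rg'(6 := int (Suc k))) mem')"
    if *: "k < n" "?I k rg1 mem1" "rg1 6 = int k" "rg1 rn = int n" for k rg1 mem1
  proof -
    let ?ag = "agree q X k c"
    have ag: "0 \<le> ?ag" "?ag \<le> int q" by (rule agree_bounds)+
    have bk: "best mem1 k = best mem k" "0 \<le> best mem k" "best mem k \<le> int q"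
      using * best[of k] by auto
    have regs: "sizes rg1" "rg1 5 = int c" "input mem1"
      using * assms by (auto simp: same_except_def sizes_def input_def)
    \<comment> \<open>\<open>M\<close> describes the memory after either branch, so the rest of the
      body is treated without a case split.\<close>
    define M where "M = (if best mem k \<le> ?ag then mem1(- 1 - int k := ?ag, - 1 - int n - int k := int c) else mem1)"
    have upd: "run K ?upd 40 (rg2, mem1) (\<lambda>rg3 mem3. mem3 = M \<and> rg3 = rg2(9 := max (best mem k) ?ag))"
      if "rg2 8 = ?ag" "rg2 9 = best mem k" "rg2 5 = int c" "rg2 6 = int k" "rg2 rn = int n" for rg2
      apply (rule run_time)
       apply (rule run_If[where T = 1 and T' = 30])
      subgoal by (simp add: fit_def)
      subgoal using that by (intro run_Skip) (auto simp: M_def split: if_splits)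
      subgoal
        apply (rule run_time)
         apply (rule run_straight)+
        using that ag K(4) by (auto simp: M_def fit_def best_addr_def centre_addr_def split: if_splits)
      by simp
    have mn: "run K ?min 20 (rg3, M) (\<lambda>rg4 mem4. mem4 = M \<and>
        rg4 = (if rg3 9 \<le> rg3 11 then rg3(11 := rg3 9, 12 := rg3 6) else rg3))"
      if "0 \<le> rg3 9" "rg3 9 \<le> int q" "rg3 6 = int k" for rg3
      apply (rule run_time)
       apply (rule run_If[where T = 1 and T' = 10])
      subgoal by (simp add: fit_def)
      subgoal by (intro run_Skip) (auto split: if_splits)
      subgoal
        apply (rule run_time)
         apply (rule run_straight)+
        using that K(2,4) * by (auto simp: fit_def split: if_splits)
      by simp
    have seq: "run K (Seq (Load 9 best_addr) (Seq ?upd ?min)) 70 (rg2, mem1)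
        (\<lambda>rg4 mem4. mem4 = M \<and> rg4 8 = ?ag \<and> rg4 9 = max (best mem k) ?ag \<and>
          rg4 11 = min (rg2 11) (max (best mem k) ?ag) \<and>
          rg4 12 = (if max (best mem k) ?ag \<le> rg2 11 then int k else rg2 12) \<and> same_except {9, 11, 12} rg2 rg4)"
      if "rg2 8 = ?ag" "rg2 5 = int c" "rg2 6 = int k" "rg2 rn = int n" for rg2
      apply (rule run_time)
       apply (rule run_Seq)
       apply (rule run_Load)
         apply (rule run_Seq_via)
          apply (rule upd)
      using that bk K(4) rn_cases apply (auto simp: best_addr_def best_def)[5]
         apply (elim conjE, hypsubst)
         apply (rule run_conseq[OF mn])
      using that bk ag K(4) by (auto simp: fit_def best_addr_def best_def same_except_def min_def max_def)
    have M: "\<forall>a\<ge>0. M a = mem1 a"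
        "\<And>i. i < n \<Longrightarrow> best M i = (if i = k then max (best mem k) ?ag else best mem1 i)"
        "\<And>i. i < n \<Longrightarrow> centre M i = (if i = k \<and> best mem k \<le> ?ag then int c else centre mem1 i)"
      using *(1) bk by (auto simp: M_def)
    have inv: "rg4 6 = int k \<and> rg4 rn = int n \<and> ?I (Suc k) (rg4(6 := int (Suc k))) M"
      if rg2: "same_except {7, 8, 9, 10} rg1 rg2"
        and rg4: "rg4 11 = min (rg2 11) (max (best mem k) ?ag)"
          "rg4 12 = (if max (best mem k) ?ag \<le> rg2 11 then int k else rg2 12)"
          "same_except {9, 11, 12} rg2 rg4" for rg2 rg4
    proof -
      have old: "rg2 11 = rg1 11" "rg2 12 = rg1 12" using rg2 by (auto simp: same_except_def)
      have "rg4 6 = int k" "rg4 rn = int n" "same_except {6, 7, 8, 9, 10, 11, 12} rg (rg4(6 := int (Suc k)))"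
        using *(2-4) rg2 rg4(3) rn_cases by (auto simp: same_except_def)
      moreover have "\<exists>x<Suc k. rg4 12 = int x \<and> rg4 11 = best M x"
      proof (cases "max (best mem k) ?ag \<le> rg2 11")
        case True
        then show ?thesis using rg4 M(2)[of k] *(1) by (intro exI[of _ k]) auto
      next
        case False
        \<comment> \<open>At \<open>k = 0\<close> register 11 is \<open>q\<close>, which no
          agreement exceeds, so the first point would have been taken.\<close>
        then have "0 < k" 
          using *(2) old bk ag by (cases k) (auto simp: same_except_def assms(5)) 
        then obtain x where "x < k" "rg1 12 = int x" "rg1 11 = best mem1 x" using *(2) by auto
        then show ?thesis using False rg4 old M(2)[of x] *(1) by (intro exI[of _ x]) auto
      qed
      moreover have "rg4 11 \<le> best M i" if "i < Suc k" for i
      proof (cases "i = k")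
        case False
        then have "rg1 11 \<le> best mem1 i" using *(2) that by auto
        then show ?thesis using False that rg4(1) old M(2)[of i] *(1) by auto
      qed (use rg4(1) M(2) *(1) in auto)
      ultimately show ?thesis
        using *(1,2) M rg4(1) old ag bk by (auto simp: less_Suc_eq)
    qed
    show ?thesis
      apply (rule run_time)
       apply (rule run_Seq_via)
        apply (rule run_agree[OF regs(1,3,2) *(3) assms(4) *(1)])
       apply (elim conjE, hypsubst)
       apply (rule run_conseq[OF seq])
      subgoal by simp
      subgoal using regs by (simp add: same_except_def)
      subgoal using * by (simp add: same_except_def)
      subgoal using * rn_cases by (auto simp: same_except_def)
      subgoal for rg2 mem2 rg4 mem4
        using inv[of rg2 rg4] by simp
      by simp
  qed
  show ?thesis
    unfolding update_prog_def
    apply (rule run_time)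
     apply (rule run_For[where I = ?I and n = n, OF _ _ _ _ step])
    subgoal using sizes_rn assms by blast
    subgoal using K by simp
    subgoal using rn_cases by auto
    subgoal using assms by (auto simp: same_except_def)
            apply (assumption+)[4]
    subgoal for rg' mem'
      using n by (auto simp: same_except_def)
    by simp
qed

section \<open>Exact inner products for a centre\<close>

lemma ev_exact_addr: "sizes rg \<Longrightarrow> ev (exact_addr aO) rg = oO (rg 5) (rg 13) + int (p * r)"
  using ev_aO[of rg 5 13] by (simp add: exact_addr_def sizes_def)

text \<open>The frame clause lists the overwritten cells individually, since they need not be
  contiguous; \<open>inj_oO\<close> then shows that the results of other centres survive.\<close>

lemma run_exact:
  assumes "sizes rg" "input mem" "rg 5 = int c" "c < n"
  shows "run K (exact_prog rm aX aY aO) (m * (70 * q + 60) + 6) (rg, mem)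
    (\<lambda>rg' mem'. (\<forall>j<m. exact mem' (int c) j = dot q X Y c j) \<and>
      (\<forall>a. (\<forall>j<m. a \<noteq> oO (int c) (int j) + int (p * r)) \<longrightarrow> mem' a = mem a) \<and>
      same_except {7, 8, 9, 10, 13} rg rg')"
proof -
  let ?I = "\<lambda>k rg' mem'. (\<forall>j<k. exact mem' (int c) j = dot q X Y c j) \<and>
      (\<forall>a. (\<forall>j<m. a \<noteq> oO (int c) (int j) + int (p * r)) \<longrightarrow> mem' a = mem a) \<and>
      same_except {7, 8, 9, 10, 13} rg rg'"
  have step: "run K (Seq (dot_prog aX aY) (Store (exact_addr aO) (R 8))) (70 * q + 50) (rg1, mem1)
      (\<lambda>rg' mem'. rg' 13 = int k \<and> rg' rm = int m \<and> ?I (Suc k) (rg'(13 := int (Suc k))) mem')"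
    if *: "k < m" "?I k rg1 mem1" "rg1 13 = int k" "rg1 rm = int m" for k rg1 mem1
  proof -
    \<comment> \<open>Results are stored above both input and output, so the next inner product
      still reads the original matrices.\<close>
    have "mem1 a = mem a" if "a < int (p * q + q * r)" for a
    proof -
      have "a \<noteq> oO (int c) (int j) + int (p * r)" if "j < m" for j
        using oO[OF assms(4) that] \<open>a < _\<close> by linarith
      then show ?thesis using *(2) by blast
    qed
    then have inp: "input mem1" using assms(2) by (simp add: input_def)
    have regs: "sizes rg1" "rg1 5 = int c"
      using * assms by (auto simp: same_except_def sizes_def)
    have inv: "rg2 13 = int k \<and> rg2 rm = int m \<and> ?I (Suc k) (rg2(13 := int (Suc k)))
        (mem1(ev (exact_addr aO) rg2 := ev (R 8) rg2))"
      if rg2: "rg2 8 = dot q X Y c k" "same_except {7, 8, 9, 10} rg1 rg2" for rg2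
    proof -
      have "sizes rg2" "rg2 5 = int c" "rg2 13 = int k" "rg2 rm = int m"
        using rg2 regs * rm_cases by (auto simp: same_except_def sizes_def)
      moreover from this have "ev (exact_addr aO) rg2 = oO (int c) (int k) + int (p * r)"
        using ev_exact_addr by simp
      moreover have "oO (int c) (int j) \<noteq> oO (int c) (int k)" if "j < k" for j
        using inj_oO[of c j c k] that *(1) assms(4) by auto
      moreover have "same_except {7, 8, 9, 10, 13} rg (rg2(13 := int (Suc k)))"
        using rg2 *(2) by (auto simp: same_except_def)
      ultimately show ?thesis
        using *(1,2) rg2(1) by (auto simp: exact_def less_Suc_eq)
    qed
    show ?thesis
      apply (rule run_time)
       apply (rule run_Seq_via)
        apply (rule run_dot[OF regs(1) inp regs(2) *(3) assms(4) *(1)])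
       apply (elim conjE, hypsubst)
       apply (rule run_Store)
         apply (rule inv)
      using asize(3)[of 5 13] by (auto simp: simple exact_addr_def fit_def)
  qed
  show ?thesis
    unfolding exact_prog_def
    apply (rule run_time)
     apply (rule run_For[where I = ?I and n = m, OF _ _ _ _ step])
    subgoal using sizes_rm assms by blast
    subgoal using K by simp
    subgoal using rm_cases by auto
    subgoal by (auto simp: same_except_def)
            apply (assumption+)[4]
    subgoal by blast
    by simp
qed

text \<open>Each \<open>z t'\<close> is a point whose distance to the closest of \<open>z 0, \<dots>, z (t' - 1)\<close> is largest;
small distance is large agreement.\<close>

definition farthest :: "(nat \<Rightarrow> nat) \<Rightarrow> nat \<Rightarrow> bool" where
  "farthest z s \<longleftrightarrow> (\<forall>t\<le>s. z t < n) \<and>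
     (\<forall>t'\<le>s. \<forall>t<t'. \<forall>i<n. \<exists>u<t'. agree q X (z t') (z t) \<le> agree q X i (z u))"

text \<open>For \<open>s = 0\<close> the first clause describes zeroed memory. From
  \<open>s = 1\<close> on every point has a centre among \<open>z 0\<close> to
  \<open>z (s - 1)\<close>; the point \<open>z s\<close> is only the next candidate.\<close>

definition clustered :: "(nat \<Rightarrow> nat) \<Rightarrow> nat \<Rightarrow> (int \<Rightarrow> int) \<Rightarrow> bool" where
  "clustered z s mem \<longleftrightarrow>
     (\<forall>i<n. (s = 0 \<and> best mem i = 0) \<or> (\<exists>t<s. centre mem i = int (z t) \<and> best mem i = agree q X i (z t))) \<and>
     (\<forall>i<n. \<forall>t<s. agree q X i (z t) \<le> best mem i) \<and>
     (\<forall>t<s. \<forall>j<m. exact mem (int (z t)) j = dot q X Y (z t) j)"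

text \<open>The effect of one round, free of program syntax: \<open>mem1\<close> is the memory after
  the pass over the points, \<open>mem2\<close> the memory after the exact products of
  \<open>z k\<close>. The point \<open>x\<close> of smallest agreement with its own centre extends
  the sequence.\<close>

lemma clustered_step:
  assumes far: "farthest z k" and cl: "clustered z k mem"
    and best1: "\<forall>i<n. best mem1 i = max (best mem i) (agree q X i (z k))"
    and centre1: "\<forall>i<n. centre mem1 i = (if best mem i \<le> agree q X i (z k) then int (z k) else centre mem i)"
    and nonneg: "\<forall>a\<ge>0. mem1 a = mem a"
    and x: "x < n" "\<forall>i<n. best mem1 x \<le> best mem1 i"
    and ex: "\<forall>j<m. exact mem2 (int (z k)) j = dot q X Y (z k) j"
    and frame: "\<forall>a. (\<forall>j<m. a \<noteq> oO (int (z k)) (int j) + int (p * r)) \<longrightarrow> mem2 a = mem1 a"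
  shows "farthest (z(Suc k := x)) (Suc k)" and "clustered (z(Suc k := x)) (Suc k) mem2"
proof -
  let ?z = "z(Suc k := x)"
  have zn: "\<And>t. t \<le> k \<Longrightarrow> z t < n" using far by (auto simp: farthest_def)
  have neg: "mem2 a = mem1 a" if "a < 0" for a
  proof -
    have "a \<noteq> oO (int (z k)) (int j) + int (p * r)" if "j < m" for j
      using oO[OF zn[OF order.refl] that] \<open>a < 0\<close> by linarith
    then show ?thesis using frame by blast
  qed
  have b2: "best mem2 i = best mem1 i" "centre mem2 i = centre mem1 i" for i
    using neg by (auto simp: best_def centre_def)
  have cl1: "(k = 0 \<and> best mem i = 0) \<or> (\<exists>t<k. centre mem i = int (z t) \<and> best mem i = agree q X i (z t))"
    and cl2: "t < k \<Longrightarrow> agree q X i (z t) \<le> best mem i" if "i < n" for i t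
    using conjunct1[OF cl[unfolded clustered_def]] conjunct1[OF conjunct2[OF cl[unfolded clustered_def]]] that by simp_all
  have attained: "\<exists>t<Suc k. centre mem1 i = int (z t) \<and> best mem1 i = agree q X i (z t)" if "i < n" for i
  proof (cases "best mem i \<le> agree q X i (z k)")
    case True
    then show ?thesis using that best1 centre1 by (intro exI[of _ k]) auto
  next
    case False
    \<comment> \<open>The stored value exceeds a nonnegative agreement, so it is not the initial 0
      and belongs to an earlier centre.\<close>
    then have "\<not> (k = 0 \<and> best mem i = 0)" using agree_bounds(1)[of q X i "z k"] by auto
    then obtain t where "t < k" "centre mem i = int (z t)" "best mem i = agree q X i (z t)"
      using cl1[OF \<open>i < n\<close>] by auto
    then show ?thesis using False that best1 centre1 by (intro exI[of _ t]) auto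
  qed
  have upper: "agree q X i (z t) \<le> best mem1 i" if "i < n" "t < Suc k" for i t
    using that best1 cl2[of i t] by (cases "t = k") force+
  show "farthest ?z (Suc k)"
    unfolding farthest_def
  proof (intro conjI allI impI)
    show "?z t < n" if "t \<le> Suc k" for t using that zn x by auto
    show "\<exists>u<t'. agree q X (?z t') (?z t) \<le> agree q X i (?z u)"
      if t: "t' \<le> Suc k" "t < t'" and i: "i < n" for t' t i
    proof (cases "t' = Suc k")
      case True
      obtain u where u: "u < Suc k" "best mem1 i = agree q X i (z u)" using attained[OF i] by blast
      \<comment> \<open>The stored value of \<open>x\<close> bounds its agreement with every centre,
        and the minimality of \<open>x\<close> passes this bound on to \<open>i\<close>, whose
        stored value is attained at \<open>z u\<close>.\<close>
      have "agree q X x (z t) \<le> best mem1 x" "best mem1 x \<le> best mem1 i"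
        using upper[OF x(1), of t] x(2) t i True by auto
      then show ?thesis using u True t by (intro exI[of _ u]) auto
    next
      case False
      then have "t' \<le> k" using t by simp
      then obtain u where "u < t'" "agree q X (z t') (z t) \<le> agree q X i (z u)"
        using conjunct2[OF far[unfolded farthest_def]] t i by blast
      then show ?thesis using False t by (intro exI[of _ u]) auto
    qed
  qed
  have "exact mem2 (int (z t)) j = dot q X Y (z t) j" if "t < Suc k" "j < m" for t j
  \<comment> \<open>A point may be chosen twice, for instance when all points coincide. Its results
    are then rewritten with the same values, so the split is on points rather than indices.\<close>
  proof (cases "z t = z k")
    case True then show ?thesis using ex that by simp
  next
    case False
    have t: "t < k" using that False by (auto simp: less_Suc_eq)
    have "oO (int (z t)) (int j) \<noteq> oO (int (z k)) (int j')" if "j' < m" for j'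
      using inj_oO[of "z t" j "z k" j'] False \<open>j < m\<close> that zn[of t] zn[of k] t by auto
    then have "mem2 (oO (int (z t)) (int j) + int (p * r)) = mem1 (oO (int (z t)) (int j) + int (p * r))"
      using frame by simp
    also have "\<dots> = mem (oO (int (z t)) (int j) + int (p * r))"
    proof -
      have "0 \<le> oO (int (z t)) (int j) + int (p * r)" using oO[OF zn[of t] that(2)] t by linarith
      then show ?thesis using nonneg by blast
    qed
    finally show ?thesis using cl t that by (simp add: clustered_def exact_def)
  qed
  then show "clustered ?z (Suc k) mem2"
    unfolding clustered_def b2 using attained upper by simp (metis nat_neq_iff)
qed

lemma run_cluster:
  assumes "sizes rg" "rg 5 = 0" "mem = m0"
  shows "run K (cluster_prog rn rm aX aY aO) (l * (n * (70 * q + 100) + m * (70 * q + 60) + 30) + 6) (rg, mem)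
    (\<lambda>rg' mem'. sizes rg' \<and> (\<exists>z. farthest z l \<and> clustered z l mem'))"
proof -
  \<comment> \<open>The sequence \<open>z\<close> is extended in each round; register 5 holds its
    newest member, the centre about to be processed.\<close>
  let ?I = "\<lambda>k rg' mem'. sizes rg' \<and> input mem' \<and> (\<exists>z. farthest z k \<and> clustered z k mem' \<and> rg' 5 = int (z k))"
  have step: "run K (Seq (Assign 11 (R 1)) (Seq (update_prog rn aX) (Seq (exact_prog rm aX aY aO) (Assign 5 (R 12)))))
      (n * (70 * q + 100) + m * (70 * q + 60) + 20) (rg1, mem1)
      (\<lambda>rg' mem'. rg' 4 = int k \<and> rg' 3 = int l \<and> ?I (Suc k) (rg'(4 := int (Suc k))) mem')"
    if *: "k < l" "?I k rg1 mem1" "rg1 4 = int k" "rg1 3 = int l" for k rg1 mem1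
  proof -
    obtain z where z: "farthest z k" "clustered z k mem1" "rg1 5 = int (z k)" using *(2) by blast
    have zk: "z k < n" using z(1) by (auto simp: farthest_def)
    have reg: "sizes rg1" "input mem1" using *(2) by auto
    have q1: "rg1 1 = int q" using reg by (auto simp: sizes_def)
    have b: "0 \<le> best mem1 i \<and> best mem1 i \<le> int q" if "i < n" for i
      using z(2) that agree_bounds unfolding clustered_def by (metis of_nat_0_le_iff order.refl)
    have upd: "run K (update_prog rn aX) (n * (70 * q + 100) + 6) (rg1(11 := ev (R 1) rg1), mem1)
        (\<lambda>rg' mem'. (\<forall>a\<ge>0. mem' a = mem1 a) \<and>
          (\<forall>i<n. best mem' i = max (best mem1 i) (agree q X i (z k))) \<and>
          (\<forall>i<n. centre mem' i = (if best mem1 i \<le> agree q X i (z k) then int (z k) else centre mem1 i)) \<and>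
          (\<exists>x<n. rg' 12 = int x \<and> (\<forall>i<n. best mem' x \<le> best mem' i)) \<and>
          same_except {6, 7, 8, 9, 10, 11, 12} (rg1(11 := ev (R 1) rg1)) rg')"
      using reg z zk q1 b by (intro run_update) (auto simp: sizes_def)
    have tail: "run K (Seq (exact_prog rm aX aY aO) (Assign 5 (R 12))) (m * (70 * q + 60) + 6 + 2) (rg2, mem2)
        (\<lambda>rg' mem'. rg' 4 = int k \<and> rg' 3 = int l \<and> ?I (Suc k) (rg'(4 := int (Suc k))) mem')"
      if nonneg: "\<forall>a\<ge>0. mem2 a = mem1 a"
        and best2: "\<forall>i<n. best mem2 i = max (best mem1 i) (agree q X i (z k))"
        and centre2: "\<forall>i<n. centre mem2 i = (if best mem1 i \<le> agree q X i (z k) then int (z k) else centre mem1 i)"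
        and x: "x < n" "rg2 12 = int x" "\<forall>i<n. best mem2 x \<le> best mem2 i"
        and rg2: "same_except {6, 7, 8, 9, 10, 11, 12} (rg1(11 := ev (R 1) rg1)) rg2" for rg2 mem2 x
    proof -
      have r2: "sizes rg2" "input mem2" "rg2 5 = int (z k)" "rg2 4 = int k"
        using reg z(3) rg2 nonneg *(3) by (auto simp: sizes_def same_except_def input_def)
      have fin: "rg3 4 = int k \<and> rg3 3 = int l \<and> ?I (Suc k) (rg3(5 := rg3 12, 4 := int (Suc k))) mem3 \<and> rg3 12 = int x"
        if ex: "\<forall>j<m. exact mem3 (int (z k)) j = dot q X Y (z k) j"
          and frame: "\<forall>a. (\<forall>j<m. a \<noteq> oO (int (z k)) (int j) + int (p * r)) \<longrightarrow> mem3 a = mem2 a"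
          and rg3: "same_except {7, 8, 9, 10, 13} rg2 rg3" for rg3 mem3
      proof -
        have "mem3 a = mem2 a" if "a < int (p * q + q * r)" for a
        proof -
          have "a \<noteq> oO (int (z k)) (int j) + int (p * r)" if "j < m" for j
            using oO[OF zk that] \<open>a < _\<close> by linarith
          then show ?thesis using frame by blast
        qed
        then have "input mem3" using r2 by (simp add: input_def)
        moreover have "sizes rg3" "rg3 12 = int x" "rg3 4 = int k"
          using rg3 r2 x by (auto simp: sizes_def same_except_def)
        moreover note clustered_step[OF z(1,2) best2 centre2 nonneg x(1,3) ex frame]
        ultimately show ?thesis
          by (auto simp: sizes_def intro!: exI[of _ "z(Suc k := x)"])
      qed
      show ?thesis
        apply (rule run_time)
         apply (rule run_Seq_via)
          apply (rule run_exact[OF r2(1,2,3) zk])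
         apply (rule run_Assign)
        subgoal for rg3 mem3 unfolding ev.simps using fin[of mem3 rg3] by (auto simp del: of_nat_Suc)
        subgoal by (simp add: fit_def)
        subgoal for rg3 mem3 using fin[of mem3 rg3] x(1) K(2) by simp
        by simp
    qed
    show ?thesis
      apply (rule run_time)
       apply (rule run_Seq)
       apply (rule run_Assign)
         apply (rule run_Seq_via)
          apply (rule upd)
         apply (elim conjE exE)
         apply (rule tail)
               apply assumption+
      using q1 K(4) by (auto simp: fit_def)
  qed
  have init: "farthest (\<lambda>_. 0) 0" "clustered (\<lambda>_. 0) 0 m0"
    using n m0_neg by (auto simp: farthest_def clustered_def best_def)
  show ?thesis
    unfolding cluster_prog_def
    apply (rule run_time)
     apply (rule run_For[where I = ?I and n = l, OF _ _ _ _ step])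
    subgoal using assms by (simp add: sizes_def)
    subgoal using K by simp
    subgoal by simp
    subgoal using init assms by (auto simp: sizes_def input_def intro!: exI[of _ "\<lambda>_. 0"])
            apply (assumption+)[4]
    subgoal by blast
    by simp
qed

text \<open>Only the output block is written. Its cells are disjoint from the stored centres at
  negative addresses and from the exact results above it, so both keep their values throughout the
  loops.\<close>

lemma run_copy:
  fixes c :: "nat \<Rightarrow> nat"
  assumes "sizes rg"
    and cn: "\<And>i. i < n \<Longrightarrow> c i < n" and centre: "\<And>i. i < n \<Longrightarrow> centre mem i = int (c i)"
    and exact: "\<And>i j. i < n \<Longrightarrow> j < m \<Longrightarrow> exact mem (int (c i)) j = dot q X Y (c i) j"
  shows "run K (copy_prog rn rm aO) (n * (m * 80 + 30) + 6) (rg, mem)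
    (\<lambda>rg' mem'. \<forall>i<n. \<forall>j<m. mem' (oO (int i) (int j)) = dot q X Y (c i) j)"
proof -
  let ?S = "int (p * q + q * r)"
  let ?I = "\<lambda>k rg' mem'. sizes rg' \<and> (\<forall>i<k. \<forall>j<m. mem' (oO (int i) (int j)) = dot q X Y (c i) j) \<and>
    (\<forall>a. a < ?S \<or> ?S + int (p * r) \<le> a \<longrightarrow> mem' a = mem a)"
  have step: "run K (Seq (Load 5 (centre_addr rn)) (For 13 rm (Seq (Load 9 (exact_addr aO)) (Store (aO 6 13) (R 9)))))
      (m * 80 + 20) (rg1, mem1)
      (\<lambda>rg' mem'. rg' 6 = int i \<and> rg' rn = int n \<and> ?I (Suc i) (rg'(6 := int (Suc i))) mem')"
    if *: "i < n" "?I i rg1 mem1" "rg1 6 = int i" "rg1 rn = int n" for i rg1 mem1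
  proof -
    have frame: "mem1 a = mem a" if "a < ?S \<or> ?S + int (p * r) \<le> a" for a
      using *(2) that by presburger
    let ?J = "\<lambda>k rg' mem'. sizes rg' \<and> rg' 5 = int (c i) \<and> rg' 6 = int i \<and>
      (\<forall>j<k. mem' (oO (int i) (int j)) = dot q X Y (c i) j) \<and>
      (\<forall>a. (\<forall>j<m. a \<noteq> oO (int i) (int j)) \<longrightarrow> mem' a = mem1 a)"
    have inner: "run K (Seq (Load 9 (exact_addr aO)) (Store (aO 6 13) (R 9))) 70 (rg2, mem2)
        (\<lambda>rg' mem'. rg' 13 = int j \<and> rg' rm = int m \<and> ?J (Suc j) (rg'(13 := int (Suc j))) mem')"
      if **: "j < m" "?J j rg2 mem2" "rg2 13 = int j" "rg2 rm = int m" for j rg2 mem2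
    proof -
      have e: "ev (exact_addr aO) rg2 = oO (int (c i)) (int j) + int (p * r)"
        using ** ev_exact_addr by simp
      have "oO (int (c i)) (int j) + int (p * r) \<noteq> oO (int i) (int j')" if "j' < m" for j'
        using oO[OF *(1) that] oO[OF cn[OF *(1)] **(1)] by linarith
      then have "mem2 (oO (int (c i)) (int j) + int (p * r)) = mem1 (oO (int (c i)) (int j) + int (p * r))"
        using **(2) by blast
      also have "\<dots> = mem (oO (int (c i)) (int j) + int (p * r))"
        using *(2) oO[OF cn[OF *(1)] **(1)] by auto
      also have "\<dots> = dot q X Y (c i) j"
        using exact[OF *(1) **(1)] by (simp add: exact_def)
      finally have v: "mem2 (oO (int (c i)) (int j) + int p * int r) = dot q X Y (c i) j" by simp
      have dK: "\<bar>dot q X Y (c i) j\<bar> \<le> K"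
        using abs_dot_le[OF cn[OF *(1)] **(1), of q] K(4) by simp
      have o: "ev (aO 6 13) (rg2(9 := dot q X Y (c i) j)) = oO (int i) (int j)"
        using ev_aO[of "rg2(9 := dot q X Y (c i) j)" 6 13] ** by (simp add: sizes_def)
      have ne: "oO (int i) (int j') \<noteq> oO (int i) (int j)" if "j' < j" for j'
        using inj_oO[of i j' i j] that **(1) *(1) by auto
      show ?thesis
        apply (rule run_time)
         apply (rule run_straight)+
        subgoal using ** ne rm_cases by (auto simp: e v o sizes_def less_Suc_eq)
        subgoal by (rule fit_addrs)
        subgoal by (simp add: fit_def)
        subgoal by (rule fit_addrs)
        subgoal using dK by (simp add: e v)
        using asize(3)[of 5 13] asize(3)[of 6 13] by (simp add: exact_addr_def)
    qed
    have ld: "mem1 (ev (centre_addr rn) rg1) = int (c i)"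
    proof -
      have "- 1 - int n - int i < ?S" by (smt (verit) of_nat_0_le_iff)
      then have "mem1 (- 1 - int n - int i) = mem (- 1 - int n - int i)" using *(2) by blast
      then show ?thesis
        using *(3,4) centre[OF *(1)] by (simp add: centre_addr_def centre_def)
    qed
    have fin: "rg' 6 = int i \<and> rg' rn = int n \<and> ?I (Suc i) (rg'(6 := int (Suc i))) mem'"
      if J: "?J m rg' mem'" for rg' mem'
    proof -
      have "mem' (oO (int i') (int j)) = dot q X Y (c i') j" if "i' < i" "j < m" for i' j
      proof -
        have "oO (int i') (int j) \<noteq> oO (int i) (int j')" if "j' < m" for j'
          using inj_oO[of i' j i j'] that \<open>i' < i\<close> \<open>j < m\<close> *(1) by auto
        then have "mem' (oO (int i') (int j)) = mem1 (oO (int i') (int j))" using J by blast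
        then show ?thesis using *(2) that by simp
      qed
      moreover have "mem' a = mem a" if "a < ?S \<or> ?S + int (p * r) \<le> a" for a
      proof -
        have "a \<noteq> oO (int i) (int j)" if "j < m" for j
          using oO[OF *(1) that] \<open>a < ?S \<or> _\<close> by linarith
        then have "mem' a = mem1 a" using J by blast
        then show ?thesis using frame[OF that] by simp
      qed
      moreover have "sizes rg'" "rg' 6 = int i" using J by blast+
      moreover have "rg' rn = int n" using sizes_rn \<open>sizes rg'\<close> by blast
      moreover have "\<forall>j<m. mem' (oO (int i) (int j)) = dot q X Y (c i) j" using J by blast
      ultimately show ?thesis unfolding less_Suc_eq sizes_def by simp
    qed
    show ?thesis
      apply (rule run_time)
       apply (rule run_Seq)
       apply (rule run_Load)
         apply (rule run_For[where I = ?J and n = m, OF _ _ _ _ inner])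
      subgoal using rm_cases sizes_rm *(2) by (auto simp: sizes_def)
      subgoal using K by simp
      subgoal using rm_cases by auto
      subgoal using *(2,3) unfolding ld by (auto simp: sizes_def)
               apply (assumption+)[4]
      subgoal by (rule fin)
      subgoal by (simp add: fit_def centre_addr_def)
      subgoal using cn[OF *(1)] K(2) unfolding ld by simp
      by (simp add: centre_addr_def)
  qed
  show ?thesis
    unfolding copy_prog_def
    apply (rule run_time)
     apply (rule run_For[where I = ?I and n = n, OF _ _ _ _ step])
    subgoal using sizes_rn assms by blast
    subgoal using K by simp
    subgoal using rn_cases by auto
    subgoal using assms by (auto simp: sizes_def)
            apply (assumption+)[4]
    subgoal by blast
    by simp
qed

end

section \<open>Approximation guarantee\<close>

text \<open>Hamming distance with coordinates numbered from 0, as in \<open>X\<close>;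
  \<open>ham\<close> numbers them from 1.\<close>

definition dist :: "nat \<Rightarrow> (nat \<Rightarrow> int) \<Rightarrow> (nat \<Rightarrow> int) \<Rightarrow> nat" where
  "dist q f g = card {h. h < q \<and> f h \<noteq> g h}"

lemma dist_sym: "dist q f g = dist q g f"
  unfolding dist_def by metis

lemma dist_triangle: "dist q f g \<le> dist q f u + dist q u g"
proof -
  have "card {h. h < q \<and> f h \<noteq> g h} \<le> card ({h. h < q \<and> f h \<noteq> u h} \<union> {h. h < q \<and> u h \<noteq> g h})"
    by (intro card_mono) auto
  also have "\<dots> \<le> dist q f u + dist q u g"
    unfolding dist_def by (rule card_Un_le)
  finally show ?thesis unfolding dist_def .
qed

text \<open>Translates between the agreements kept by the program and the distances of the
  guarantee.\<close>

lemma agree_plus_dist: "agree q X i c + int (dist q (X i) (X c)) = int q"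
proof (induction q)
  case (Suc q)
  have "{h. h < Suc q \<and> X i h \<noteq> X c h} =
      (if X i q = X c q then {h. h < q \<and> X i h \<noteq> X c h} else insert q {h. h < q \<and> X i h \<noteq> X c h})"
    by (auto simp: less_Suc_eq)
  then show ?case using Suc by (auto simp: dist_def)
qed (simp add: dist_def)

context layout
begin

text \<open>Coordinates where the two vectors agree cancel, and each other one contributes at most 1
  because \<open>Y\<close> is 0-1. The right-hand side is their Hamming distance.\<close>

lemma dot_diff_le:
  assumes "i < n" "c < n" "j < m"
  shows "\<bar>dot q X Y i j - dot q X Y c j\<bar> \<le> int q - agree q X i c"
proof -
  have "\<bar>dot k X Y i j - dot k X Y c j\<bar> \<le> int k - agree k X i c" if "k \<le> q" for k
    using that
  proof (induction k)
    case (Suc k)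
    then show ?case
      using X01[of i k] X01[of c k] Y01[of k j] assms by auto
  qed simp
  then show ?thesis by simp
qed

text \<open>Suppose \<open>i\<close> is farther than \<open>2 * d\<close> from all \<open>l\<close>
  centres. Each centre was chosen at least as far from the earlier ones as \<open>i\<close> is from
  the closest of these, so the centres and \<open>i\<close> are pairwise more than
  \<open>2 * d\<close> apart, too many points for \<open>T\<close> to cover within
  \<open>d\<close>.\<close>

lemma farthest_2approx:
  assumes far: "farthest z l"
    and T: "finite T" "card T \<le> l" "\<And>i. i < n \<Longrightarrow> \<exists>u\<in>T. dist q (X i) u \<le> d"
    and i: "i < n"
  shows "\<exists>t<l. int q - agree q X i (z t) \<le> 2 * int d"
proof (rule ccontr)
  assume "\<not> ?thesis"
  then have i_far: "agree q X i (z t) < int q - 2 * int d" if "t < l" for t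
    using that by force
  \<comment> \<open>The candidate \<open>z l\<close> is replaced by \<open>i\<close>, giving
    \<open>l + 1\<close> points at the indices 0 to \<open>l\<close>.\<close>
  define w where "w t = (if t < l then z t else i)" for t
  have wn: "w t < n" for t using far i by (auto simp: w_def farthest_def)
  have sep: "2 * d < dist q (X (w t')) (X (w t))" if t: "t < t'" "t' \<le> l" for t t'
  proof -
    have "agree q X (w t') (w t) < int q - 2 * int d"
    proof (cases "t' = l")
      case False
      then obtain u where u: "u < t'" "agree q X (z t') (z t) \<le> agree q X i (z u)"
        using conjunct2[OF far[unfolded farthest_def]] i t by blast
      then show ?thesis using i_far[of u] t False by (simp add: w_def)
    qed (use t i_far[of t] in \<open>simp add: w_def\<close>)
    then show ?thesis using agree_plus_dist[of q X "w t'" "w t"] by linarith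
  qed
  obtain f where f: "\<And>t. f t \<in> T" "\<And>t. dist q (X (w t)) (f t) \<le> d"
    using T(3)[OF wn] by metis
  \<comment> \<open>Pigeonhole: \<open>l + 1\<close> indices are mapped into a set of at most
    \<open>l\<close> points.\<close>
  have "\<not> inj_on f {..l}"
  proof
    assume "inj_on f {..l}"
    then have "card {..l} \<le> card T"
      using f(1) T(1) by (intro card_inj_on_le) auto
    then show False using T(2) by simp
  qed
  then obtain t t' where tt: "t < t'" "t' \<le> l" "f t = f t'"
    unfolding inj_on_def by (metis atMost_iff linorder_neqE_nat)
  have "dist q (X (w t')) (X (w t)) \<le> dist q (X (w t')) (f t') + dist q (f t') (X (w t))"
    by (rule dist_triangle)
  also have "\<dots> \<le> d + d"
    using f(2)[of t'] f(2)[of t] tt(3) dist_sym[of q "X (w t)"] by simp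
  finally show False using sep[OF tt(1,2)] by simp
qed

lemma run_approx:
  assumes "sizes rg" "rg 5 = 0" "1 \<le> l"
    and T: "finite T" "card T \<le> l" "\<And>i. i < n \<Longrightarrow> \<exists>u\<in>T. dist q (X i) u \<le> d"
  shows "run K (approx_prog rn rm aX aY aO)
    (l * (n * (70 * q + 100) + m * (70 * q + 60) + 30) + 6 + (n * (m * 80 + 30) + 6)) (rg, m0)
    (\<lambda>rg' mem'. \<forall>i<n. \<forall>j<m. \<bar>dot q X Y i j - mem' (oO (int i) (int j))\<bar> \<le> 2 * int d)"
  unfolding approx_prog_def
proof (rule run_Seq_via[OF run_cluster[OF assms(1,2) refl]])
  fix rg' mem'
  assume "sizes rg' \<and> (\<exists>z. farthest z l \<and> clustered z l mem')"
  then obtain z where z: "sizes rg'" "farthest z l" "clustered z l mem'" by blast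
  have "\<exists>t<l. centre mem' i = int (z t) \<and> best mem' i = agree q X i (z t)" if "i < n" for i
    using z(3) that assms(3) by (auto simp: clustered_def)
  then obtain f where f: "\<And>i. i < n \<Longrightarrow> f i < l \<and> centre mem' i = int (z (f i)) \<and> best mem' i = agree q X i (z (f i))"
    by metis
  have zn: "z (f i) < n" if "i < n" for i
    using f[OF that] z(2) by (simp add: farthest_def)
  \<comment> \<open>The stored centre may differ from the close one found by
    \<open>farthest_2approx\<close>, but its agreement with \<open>i\<close> is at least as
    large.\<close>
  have close: "int q - agree q X i (z (f i)) \<le> 2 * int d" if i: "i < n" for i
  proof -
    obtain t where t: "t < l" "int q - agree q X i (z t) \<le> 2 * int d"
      using farthest_2approx[OF z(2) T i] by blast
    then have "agree q X i (z t) \<le> best mem' i" using z(3) i by (simp add: clustered_def)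
    then show ?thesis using t f[OF i] by simp
  qed
  show "run K (copy_prog rn rm aO) (n * (m * 80 + 30) + 6) (rg', mem')
     (\<lambda>rg' mem'. \<forall>i<n. \<forall>j<m. \<bar>dot q X Y i j - mem' (oO (int i) (int j))\<bar> \<le> 2 * int d)"
  proof (rule run_conseq[OF run_copy[where c = "\<lambda>i. z (f i)", OF z(1)]])
    show "exact mem' (int (z (f i))) j = dot q X Y (z (f i)) j" if "i < n" "j < m" for i j
      using z(3) f[OF that(1)] that by (simp add: clustered_def)
    fix rg2 mem2
    assume "\<forall>i<n. \<forall>j<m. mem2 (oO (int i) (int j)) = dot q X Y (z (f i)) j"
    then show "\<forall>i<n. \<forall>j<m. \<bar>dot q X Y i j - mem2 (oO (int i) (int j))\<bar> \<le> 2 * int d"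
      using order_trans[OF dot_diff_le[OF _ zn] close] by simp
  qed (use zn f in auto)
qed

end
section \<open>Rows of A and columns of B\<close>

definition entryA :: "nat \<Rightarrow> nat \<Rightarrow> aexp" where
  "entryA x y = Plus (Times (R x) (R 1)) (R y)"

definition entryB :: "nat \<Rightarrow> nat \<Rightarrow> aexp" where
  "entryB x y = Plus (Plus (Times (R 0) (R 1)) (Times (R x) (R 2))) (R y)"

definition entryD :: "nat \<Rightarrow> nat \<Rightarrow> aexp" where
  "entryD x y = Plus (Plus (Plus (Times (R 0) (R 1)) (Times (R 1) (R 2))) (Times (R x) (R 2))) (R y)"

section \<open>Row-major addresses and the initial memory\<close>

lemma row_major_bound:
  fixes i h p q :: nat
  assumes "i < p" "h < q"
  shows "i * q + h < p * q"
proof -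
  have "i * q + h < Suc i * q" using assms by simp
  also have "\<dots> \<le> p * q" using assms by (intro mult_right_mono) auto
  finally show ?thesis .
qed

lemma row_major_inj:
  fixes i h i' h' q :: nat
  assumes "i * q + h = i' * q + h'" "h < q" "h' < q"
  shows "i = i' \<and> h = h'"
proof -
  have "(i * q + h) div q = i" "(i * q + h) mod q = h" "(i' * q + h') div q = i'" "(i' * q + h') mod q = h'"
    using assms(2,3) by auto
  then show ?thesis using assms(1) by metis
qed

lemma init_memory_A:
  assumes "i < p" "h < q"
  shows "snd (init_state p q r par A B) (int i * int q + int h) = A (Suc i) (Suc h)"
proof -
  have "int i * int q + int h = int (i * q + h)" by simp
  then show ?thesis
    using row_major_bound[OF assms] assms by (simp add: init_state_def del: of_nat_add of_nat_mult)
qed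

lemma init_memory_B:
  assumes "h < q" "j < r"
  shows "snd (init_state p q r par A B) (int p * int q + int h * int r + int j) = B (Suc h) (Suc j)"
proof -
  have "int p * int q + int h * int r + int j = int (p * q + (h * r + j))" by simp
  then show ?thesis
    using row_major_bound[OF assms] assms by (simp add: init_state_def del: of_nat_add of_nat_mult)
qed

lemma ham_eq_dist: "ham q f u = dist q (\<lambda>h. f (Suc h)) (\<lambda>h. u (Suc h))"
proof -
  have "{h \<in> {1..q}. f h \<noteq> u h} = Suc ` {h. h < q \<and> f (Suc h) \<noteq> u (Suc h)}"
    by (force simp: image_iff Suc_le_eq gr0_conv_Suc)
  then show ?thesis by (simp add: ham_def dist_def card_image)
qed

text \<open>The zero vector alone covers everything within distance \<open>q\<close>, so the minimum
  is attained. The optimal points are then shifted to coordinates starting at 0.\<close>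

lemma lambda_row_witness:
  assumes "1 \<le> l"
  obtains T where "finite T" "card T \<le> l"
    "\<And>i. i < p \<Longrightarrow> \<exists>u\<in>T. dist q (\<lambda>h. A (Suc i) (Suc h)) u \<le> lambda_row p q A l"
proof -
  let ?P = "\<lambda>d. \<exists>T. T \<subseteq> cube q \<and> finite T \<and> T \<noteq> {} \<and> card T \<le> l \<and>
    (\<forall>i\<in>{1..p}. \<exists>u\<in>T. ham q (\<lambda>h. A i h) u \<le> d)"
  have "ham q f u \<le> q" for f u
    unfolding ham_eq_dist dist_def using card_mono[of "{..<q}" "{h. h < q \<and> f (Suc h) \<noteq> u (Suc h)}"] by auto
  then have "?P q"
    using assms by (intro exI[of _ "{\<lambda>_. 0}"]) (auto simp: cube_def)
  then have "?P (lambda_row p q A l)" unfolding lambda_row_def by (rule LeastI)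
  then obtain T where T: "finite T" "card T \<le> l" "\<forall>i\<in>{1..p}. \<exists>u\<in>T. ham q (\<lambda>h. A i h) u \<le> lambda_row p q A l"
    by blast
  show ?thesis
  proof (rule that)
    show "finite ((\<lambda>u h. u (Suc h)) ` T)" using T(1) by simp
    show "card ((\<lambda>u h. u (Suc h)) ` T) \<le> l" using T(1,2) card_image_le order_trans by blast
    show "\<exists>u\<in>(\<lambda>u h. u (Suc h)) ` T. dist q (\<lambda>h. A (Suc i) (Suc h)) u \<le> lambda_row p q A l" if "i < p" for i
      using T(3) that by (auto simp: ham_eq_dist dest!: bspec[of _ _ "Suc i"])
  qed
qed

lemma lambda_col_eq_row: "lambda_col q r B k = lambda_row r q (\<lambda>j h. B h j) k"
  by (simp add: lambda_col_def lambda_row_def)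

text \<open>The sum \<open>p + q + r\<close> serves as \<open>K\<close>: it is at least 2 and bounds
  all four input registers, and the word bound is its 40th power.\<close>

lemma run_init_state:
  assumes "run (int (p + q + r)) P t (init_state p q r par A B) (\<lambda>rg m. Q (rg, m))"
    and "1 \<le> p" "1 \<le> q" "par \<le> p + q + r"
  shows "\<exists>t' s'. big_step (int ((p + q + r) ^ 40)) P (init_state p q r par A B) t' s' \<and> t' \<le> t \<and> Q s'"
proof -
  have "bounded_regs (int (p + q + r)) (fst (init_state p q r par A B))"
    using assms by (auto simp: bounded_regs_def init_state_def)
  then show ?thesis
    using assms unfolding run_def by fastforce
qed

text \<open>By \<open>m \<le> n\<close>, the cost of order \<open>l * m * q\<close> for the exact
  products is absorbed by \<open>n * q * l\<close>. A round costs at most 170 + 130 + 30 = 330 times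
  \<open>n * q\<close>, copying at most 110 times \<open>n * m\<close>, and the remaining 12 is
  covered since \<open>n * m\<close> is positive.\<close>

lemma time_bound:
  fixes l n m q :: nat
  assumes "1 \<le> l" "1 \<le> n" "1 \<le> m" "1 \<le> q" "m \<le> n"
  shows "l * (n * (70 * q + 100) + m * (70 * q + 60) + 30) + 6 + (n * (m * 80 + 30) + 6) \<le> 500 * (n * q * l + n * m)"
proof -
  have "n * (70 * q + 100) + m * (70 * q + 60) + 30 \<le> n * (170 * q) + n * (130 * q) + 30 * (n * q)"
    using assms by (intro add_mono mult_mono) auto
  then have "l * (n * (70 * q + 100) + m * (70 * q + 60) + 30) \<le> l * (330 * (n * q))"
    by (intro mult_left_mono) (auto simp: algebra_simps)
  then have clusters: "l * (n * (70 * q + 100) + m * (70 * q + 60) + 30) \<le> 330 * (n * q * l)"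
    by (simp add: mult_ac)
  have copies: "n * (m * 80 + 30) \<le> 110 * (n * m)"
    using assms by (simp add: add_mult_distrib2)
  have "1 \<le> n * m" using assms by simp
  then have "330 * (n * q * l) + 6 + (110 * (n * m) + 6) \<le> 500 * (n * q * l + n * m)"
    by (simp only: add_mult_distrib2)
  then show ?thesis using clusters copies by (meson add_mono order.refl order_trans)
qed

lemma approx_rows:
  assumes "1 \<le> p" "1 \<le> q" "1 \<le> r" "1 \<le> l" "l \<le> p" "r \<le> p" "zero_one A p q" "zero_one B q r"
  shows "\<exists>t s'. big_step (int ((p + q + r) ^ 40)) (approx_prog 0 2 entryA entryB entryD) (init_state p q r l A B) t s' \<and>
    t \<le> 500 * (p * q * l + p * r) \<and>
    (\<forall>i\<in>{1..p}. \<forall>j\<in>{1..r}. \<bar>mat_prod q A B i j - ram_output p q r s' i j\<bar> \<le> 2 * int (lambda_row p q A l))"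
proof -
  obtain T where T: "finite T" "card T \<le> l"
    "\<And>i. i < p \<Longrightarrow> \<exists>u\<in>T. dist q (\<lambda>h. A (Suc i) (Suc h)) u \<le> lambda_row p q A l"
    using lambda_row_witness[OF assms(4)] by metis
  let ?X = "\<lambda>i h. A (Suc i) (Suc h)"
  let ?Y = "\<lambda>h j. B (Suc h) (Suc j)"
  let ?s = "init_state p q r l A B"
  interpret layout p q r l p r 0 2 entryA entryB entryD "\<lambda>i h. i * int q + h"
    "\<lambda>h j. int p * int q + h * int r + j" "\<lambda>i j. int p * int q + int q * int r + i * int r + j"
    ?X ?Y "snd ?s" "int (p + q + r)"
  proof
    show "0 \<le> int i * int q + int h \<and> int i * int q + int h < int (p * q + q * r) \<and>
        snd ?s (int i * int q + int h) = ?X i h" if "i < p" "h < q" for i h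
      using row_major_bound[OF that] init_memory_A[OF that] of_nat_less_iff[of "i * q + h" "p * q + q * r", where 'a = int]
      by auto
    show "0 \<le> int p * int q + int h * int r + int j \<and>
        int p * int q + int h * int r + int j < int (p * q + q * r) \<and>
        snd ?s (int p * int q + int h * int r + int j) = ?Y h j" if "h < q" "j < r" for h j
      using row_major_bound[OF that] init_memory_B[OF that] of_nat_less_iff[of "h * r + j" "q * r", where 'a = int]
      by auto
    show "int (p * q + q * r) \<le> int p * int q + int q * int r + int i * int r + int j \<and>
        int p * int q + int q * int r + int i * int r + int j < int (p * q + q * r) + int (p * r)"
      if "i < p" "j < r" for i j
      using row_major_bound[OF that] of_nat_less_iff[of "i * r + j" "p * r", where 'a = int] by auto
    show "i = i' \<and> j = j'" if "i < p" "j < r" "i' < p" "j' < r"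
      "int p * int q + int q * int r + int i * int r + int j = int p * int q + int q * int r + int i' * int r + int j'"
      for i j i' j'
    proof -
      have "int (i * r + j) = int (i' * r + j')" using that(5) by simp
      then show ?thesis using row_major_inj that by (metis of_nat_eq_iff)
    qed
  qed (use assms in \<open>auto simp: entryA_def entryB_def entryD_def zero_one_def init_state_def\<close>)
  have "run (int (p + q + r)) (approx_prog 0 2 entryA entryB entryD)
     (l * (p * (70 * q + 100) + r * (70 * q + 60) + 30) + 6 + (p * (r * 80 + 30) + 6)) (fst ?s, snd ?s)
     (\<lambda>rg' mem'. \<forall>i<p. \<forall>j<r. \<bar>dot q ?X ?Y i j - mem' (int p * int q + int q * int r + int i * int r + int j)\<bar>
        \<le> 2 * int (lambda_row p q A l))"
    by (rule run_approx[OF _ _ assms(4) T]) (auto simp: sizes_def init_state_def)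
  then have "run (int (p + q + r)) (approx_prog 0 2 entryA entryB entryD) (500 * (p * q * l + p * r)) ?s
     (\<lambda>rg' mem'. \<forall>i\<in>{1..p}. \<forall>j\<in>{1..r}. \<bar>mat_prod q A B i j - ram_output p q r (rg', mem') i j\<bar>
        \<le> 2 * int (lambda_row p q A l))"
    unfolding prod.collapse
  proof (rule run_weaken)
    show "l * (p * (70 * q + 100) + r * (70 * q + 60) + 30) + 6 + (p * (r * 80 + 30) + 6) \<le> 500 * (p * q * l + p * r)"
      using assms by (intro time_bound)
    fix rg' mem'
    assume *: "\<forall>i<p. \<forall>j<r. \<bar>dot q ?X ?Y i j - mem' (int p * int q + int q * int r + int i * int r + int j)\<bar>
        \<le> 2 * int (lambda_row p q A l)"
    show "\<forall>i\<in>{1..p}. \<forall>j\<in>{1..r}. \<bar>mat_prod q A B i j - ram_output p q r (rg', mem') i j\<bar>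
        \<le> 2 * int (lambda_row p q A l)"
    proof (intro ballI)
      fix i j assume "i \<in> {1..p}" "j \<in> {1..r}"
      then obtain i' j' where ij: "i = Suc i'" "j = Suc j'" "i' < p" "j' < r"
        by (cases i; cases j) auto
      have "mat_prod q A B i j = dot q ?X ?Y i' j'"
        by (simp add: ij mat_prod_def dot_def sum.atLeast1_atMost_eq)
      then show "\<bar>mat_prod q A B i j - ram_output p q r (rg', mem') i j\<bar> \<le> 2 * int (lambda_row p q A l)"
        using * ij by (simp add: ram_output_def)
    qed
  qed
  then show ?thesis
    using assms by (intro run_init_state) auto
qed

text \<open>The row algorithm applied to the transposed product of B and A. Swapping the arguments
  of the address expressions transposes all three matrices without moving data.\<close>

lemma approx_cols:
  assumes "1 \<le> p" "1 \<le> q" "1 \<le> r" "1 \<le> k" "k \<le> r" "p \<le> r" "zero_one A p q" "zero_one B q r"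
  shows "\<exists>t s'. big_step (int ((p + q + r) ^ 40))
      (approx_prog 2 0 (\<lambda>x y. entryB y x) (\<lambda>x y. entryA y x) (\<lambda>x y. entryD y x)) (init_state p q r k A B) t s' \<and>
    t \<le> 500 * (r * q * k + p * r) \<and>
    (\<forall>i\<in>{1..p}. \<forall>j\<in>{1..r}. \<bar>mat_prod q A B i j - ram_output p q r s' i j\<bar> \<le> 2 * int (lambda_col q r B k))"
proof -
  obtain T where T: "finite T" "card T \<le> k"
    "\<And>j. j < r \<Longrightarrow> \<exists>u\<in>T. dist q (\<lambda>h. B (Suc h) (Suc j)) u \<le> lambda_col q r B k"
    using lambda_row_witness[OF assms(4), of r q "\<lambda>j h. B h j"] unfolding lambda_col_eq_row by metis
  let ?X = "\<lambda>j h. B (Suc h) (Suc j)"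
  let ?Y = "\<lambda>h i. A (Suc i) (Suc h)"
  let ?s = "init_state p q r k A B"
  let ?prog = "approx_prog 2 0 (\<lambda>x y. entryB y x) (\<lambda>x y. entryA y x) (\<lambda>x y. entryD y x)"
  interpret layout p q r k r p 2 0 "\<lambda>x y. entryB y x" "\<lambda>x y. entryA y x" "\<lambda>x y. entryD y x"
    "\<lambda>j h. int p * int q + h * int r + j" "\<lambda>h i. i * int q + h"
    "\<lambda>j i. int p * int q + int q * int r + i * int r + j"
    ?X ?Y "snd ?s" "int (p + q + r)"
  proof
    show "0 \<le> int i * int q + int h \<and> int i * int q + int h < int (p * q + q * r) \<and>
        snd ?s (int i * int q + int h) = ?Y h i" if "h < q" "i < p" for h i
      using row_major_bound[OF that(2,1)] init_memory_A[OF that(2,1)]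
        of_nat_less_iff[of "i * q + h" "p * q + q * r", where 'a = int] by auto
    show "0 \<le> int p * int q + int h * int r + int j \<and>
        int p * int q + int h * int r + int j < int (p * q + q * r) \<and>
        snd ?s (int p * int q + int h * int r + int j) = ?X j h" if "j < r" "h < q" for j h
      using row_major_bound[OF that(2,1)] init_memory_B[OF that(2,1)]
        of_nat_less_iff[of "h * r + j" "q * r", where 'a = int] by auto
    show "int (p * q + q * r) \<le> int p * int q + int q * int r + int i * int r + int j \<and>
        int p * int q + int q * int r + int i * int r + int j < int (p * q + q * r) + int (p * r)"
      if "j < r" "i < p" for j i
      using row_major_bound[OF that(2,1)] of_nat_less_iff[of "i * r + j" "p * r", where 'a = int] by auto
    show "j = j' \<and> i = i'" if "j < r" "i < p" "j' < r" "i' < p"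
      "int p * int q + int q * int r + int i * int r + int j = int p * int q + int q * int r + int i' * int r + int j'"
      for j i j' i'
    proof -
      have "int (i * r + j) = int (i' * r + j')" using that(5) by simp
      then show ?thesis using row_major_inj that by (metis of_nat_eq_iff)
    qed
  qed (use assms in \<open>auto simp: entryA_def entryB_def entryD_def zero_one_def init_state_def\<close>)
  have "run (int (p + q + r)) ?prog
     (k * (r * (70 * q + 100) + p * (70 * q + 60) + 30) + 6 + (r * (p * 80 + 30) + 6)) (fst ?s, snd ?s)
     (\<lambda>rg' mem'. \<forall>j<r. \<forall>i<p. \<bar>dot q ?X ?Y j i - mem' (int p * int q + int q * int r + int i * int r + int j)\<bar>
        \<le> 2 * int (lambda_col q r B k))"
    by (rule run_approx[OF _ _ assms(4) T]) (auto simp: sizes_def init_state_def)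
  then have "run (int (p + q + r)) ?prog (500 * (r * q * k + p * r)) ?s
     (\<lambda>rg' mem'. \<forall>i\<in>{1..p}. \<forall>j\<in>{1..r}. \<bar>mat_prod q A B i j - ram_output p q r (rg', mem') i j\<bar>
        \<le> 2 * int (lambda_col q r B k))"
    unfolding prod.collapse
  proof (rule run_weaken)
    show "k * (r * (70 * q + 100) + p * (70 * q + 60) + 30) + 6 + (r * (p * 80 + 30) + 6) \<le> 500 * (r * q * k + p * r)"
      using time_bound[of k r p q] assms by (simp add: mult.commute)
    fix rg' mem'
    assume *: "\<forall>j<r. \<forall>i<p. \<bar>dot q ?X ?Y j i - mem' (int p * int q + int q * int r + int i * int r + int j)\<bar>
        \<le> 2 * int (lambda_col q r B k)"
    show "\<forall>i\<in>{1..p}. \<forall>j\<in>{1..r}. \<bar>mat_prod q A B i j - ram_output p q r (rg', mem') i j\<bar>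
        \<le> 2 * int (lambda_col q r B k)"
    proof (intro ballI)
      fix i j assume "i \<in> {1..p}" "j \<in> {1..r}"
      then obtain i' j' where ij: "i = Suc i'" "j = Suc j'" "i' < p" "j' < r"
        by (cases i; cases j) auto
      \<comment> \<open>Transposition reverses the factors of each term, hence the commutativity of
        multiplication.\<close>
      have "mat_prod q A B i j = dot q ?X ?Y j' i'"
        by (simp add: ij mat_prod_def dot_def sum.atLeast1_atMost_eq mult.commute)
      then show "\<bar>mat_prod q A B i j - ram_output p q r (rg', mem') i j\<bar> \<le> 2 * int (lambda_col q r B k)"
        using * ij by (simp add: ram_output_def)
    qed
  qed
  then show ?thesis
    using assms by (intro run_init_state) auto
qed

theorem theorem1:
  shows
  "(\<exists>P :: com. \<exists>c cw :: nat. \<forall>p q r l :: nat. \<forall>A B :: nat \<Rightarrow> nat \<Rightarrow> int.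
      1 \<le> p \<and> 1 \<le> q \<and> 1 \<le> r \<and> 1 \<le> l \<and> l \<le> p \<and> r \<le> p \<and>
      zero_one A p q \<and> zero_one B q r \<longrightarrow>
      (\<exists>t s'. big_step (int ((p + q + r) ^ cw)) P (init_state p q r l A B) t s' \<and>
         t \<le> c * (p * q * l + p * r) \<and>
         (\<forall>i\<in>{1..p}. \<forall>j\<in>{1..r}.
            \<bar>mat_prod q A B i j - ram_output p q r s' i j\<bar> \<le> 2 * int (lambda_row p q A l))))
   \<and>
   (\<exists>P :: com. \<exists>c cw :: nat. \<forall>p q r k :: nat. \<forall>A B :: nat \<Rightarrow> nat \<Rightarrow> int.
      1 \<le> p \<and> 1 \<le> q \<and> 1 \<le> r \<and> 1 \<le> k \<and> k \<le> r \<and> p \<le> r \<and>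
      zero_one A p q \<and> zero_one B q r \<longrightarrow>
      (\<exists>t s'. big_step (int ((p + q + r) ^ cw)) P (init_state p q r k A B) t s' \<and>
         t \<le> c * (r * q * k + p * r) \<and>
         (\<forall>i\<in>{1..p}. \<forall>j\<in>{1..r}.
            \<bar>mat_prod q A B i j - ram_output p q r s' i j\<bar> \<le> 2 * int (lambda_col q r B k))))"
  (is "?rows \<and> ?cols")
proof
  show ?rows
    by (rule exI[of _ "approx_prog 0 2 entryA entryB entryD"], rule exI[of _ 500], rule exI[of _ 40],
        intro allI impI, elim conjE)
      (rule approx_rows)
  show ?cols
    by (rule exI[of _ "approx_prog 2 0 (\<lambda>x y. entryB y x) (\<lambda>x y. entryA y x) (\<lambda>x y. entryD y x)"],
        rule exI[of _ 500], rule exI[of _ 40], intro allI impI, elim conjE)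
      (rule approx_cols)
qed

end
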